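(* Let $S=\{S(t)\}_{t\ge0}$ be a subordinator with Laplace exponent $\Phi$. Then for every $s\ge 1/2$, $$\mathrm{Dim}^{\mathrm{FH}}_s\,S([0,1])=s(1-\theta)\qquad\text{almost surely},$$ where $$\theta:=\liminf_{\lambda\uparrow\infty}\frac{1}{\log\lambda}\log\left(\int_1^\lambda\frac{\mathrm{d}x}{\Phi(x^{1/s})}\right).$$
   Context: A subordinator is a real-valued Lévy process $S$ (that is, $S(0)=0$, stationary and independent increments, almost surely right-continuous paths with left limits) such that $t\mapsto S(t)$ is nondecreasing. Its Laplace exponent $\Phi$ is given by $\mathrm{E}\,\mathrm{e}^{-\lambda S(t)}=\mathrm{e}^{-t\Phi(\lambda)}$ for all $t,\lambda>0$. $S([0,1]):=\{S(t):t\in[0,1]\}$. $\mathrm{Dim}^{\mathrm{FH}}_sF$ is the $s$-dimensional packing dimension profile of Falconer and Howroyd of a Borel set $F\subseteq\mathbf{R}$, for $s>0$. It is defined as follows. For a finite nonzero Borel measure $\mu$ on $\mathbf{R}$ let $$F_s^\mu(x,r):=\int\min\left\{1,\frac{r^s}{|y-x|^s}\right\}\mu(\mathrm{d}y),\qquad x\in\mathbf{R},\ r>0,$$ (the integrand being $1$ at $y=x$) and $$\mathrm{Dim}^{\mathrm{FH}}_s\mu:=\sup\left\{t\ge 0:\ \liminf_{r\downarrow 0}r^{-t}F_s^\mu(x,r)=0\ \text{for }\mu\text{-almost every }x\right\}.$$ Then $\mathrm{Dim}^{\mathrm{FH}}_sF:=\sup\{\mathrm{Dim}^{\mathrm{FH}}_s\mu\}$,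 where the supremum is over all finite nonzero Borel measures $\mu$ whose support is a compact subset of $F$. Convention: $\sup\varnothing:=0$. *)

theory Defs
  imports "HOL-Probability.Probability"
begin

section \<open>Subordinators\<close>

text \<open>
  A process is a family \<open>S t\<close> of random variables; only the values at times \<open>t \<ge> 0\<close> matter.
  The path properties are required almost surely. This covers processes whose paths all start
  at \<open>0\<close>, or are all nondecreasing.
\<close>

locale levy_process = prob_space M for M :: "'a measure" +
  fixes S :: "real \<Rightarrow> 'a \<Rightarrow> real"
  assumes measurable_process: "\<And>t. t \<ge> 0 \<Longrightarrow> S t \<in> borel_measurable M"
    and starts_at_0: "AE \<omega> in M. S 0 \<omega> = 0"
    and stationary_increments:
      "\<And>t h. t \<ge> 0 \<Longrightarrow> h \<ge> 0 \<Longrightarrow>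
         distr M borel (\<lambda>\<omega>. S (t + h) \<omega> - S t \<omega>) = distr M borel (\<lambda>\<omega>. S h \<omega> - S 0 \<omega>)"
    and independent_increments:
      "\<And>(n::nat) \<tau>. 0 \<le> \<tau> 0 \<Longrightarrow> (\<And>i. i < n \<Longrightarrow> \<tau> i \<le> \<tau> (Suc i)) \<Longrightarrow>
         indep_vars (\<lambda>_. borel) (\<lambda>i \<omega>. S (\<tau> (Suc i)) \<omega> - S (\<tau> i) \<omega>) {..<n}"
    and cadlag_paths:
      "AE \<omega> in M.
         (\<forall>t\<ge>0. continuous (at_right t) (\<lambda>u. S u \<omega>)) \<and>
         (\<forall>t>0. \<exists>l. ((\<lambda>u. S u \<omega>) \<longlongrightarrow> l) (at_left t))"

locale subordinator = levy_process M S for M :: "'a measure" and S :: "real \<Rightarrow> 'a \<Rightarrow> real" +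
  assumes nondecreasing_paths: "AE \<omega> in M. mono_on {0..} (\<lambda>t. S t \<omega>)"

definition laplace_exponent :: "'a measure \<Rightarrow> (real \<Rightarrow> 'a \<Rightarrow> real) \<Rightarrow> (real \<Rightarrow> real) \<Rightarrow> bool" where
  "laplace_exponent M S \<Phi> \<longleftrightarrow>
     (\<forall>t>0. \<forall>l>0. (\<integral>\<omega>. exp (- l * S t \<omega>) \<partial>M) = exp (- t * \<Phi> l))"


section \<open>Packing dimension profiles\<close>

text \<open>The case distinction is needed because division by zero yields zero in HOL.\<close>

definition profile_kernel :: "real \<Rightarrow> real measure \<Rightarrow> real \<Rightarrow> real \<Rightarrow> real" where
  "profile_kernel s \<mu> x r =
     (\<integral>y. (if y = x then 1 else min 1 (r powr s / \<bar>y - x\<bar> powr s)) \<partial>\<mu>)"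

text \<open>
  All dimensions are nonnegative extended reals. In \<^typ>\<open>ereal\<close> the supremum of the empty set is
  \<open>-\<infinity>\<close>; inserting \<open>0\<close> implements the convention that it is \<open>0\<close>, and changes nothing otherwise.
\<close>

definition Dim_FH_measure :: "real \<Rightarrow> real measure \<Rightarrow> ereal" where
  "Dim_FH_measure s \<mu> =
     Sup (insert 0 (ereal ` {t. t \<ge> 0 \<and>
       (AE x in \<mu>. Liminf (at_right 0) (\<lambda>r. ereal (r powr (- t) * profile_kernel s \<mu> x r)) = 0)}))"

definition measure_support :: "real measure \<Rightarrow> real set" where
  "measure_support \<mu> = {x. \<forall>U. open U \<longrightarrow> x \<in> U \<longrightarrow> emeasure \<mu> U > 0}"

definition Dim_FH :: "real \<Rightarrow> real set \<Rightarrow> ereal" where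
  "Dim_FH s F =
     Sup (insert 0 (Dim_FH_measure s ` {\<mu>. sets \<mu> = sets borel \<and> finite_measure \<mu> \<and>
       emeasure \<mu> UNIV \<noteq> 0 \<and> compact (measure_support \<mu>) \<and> measure_support \<mu> \<subseteq> F}))"


section \<open>The index of a Laplace exponent\<close>

text \<open>
  Meaningful only if \<open>\<Phi> > 0\<close>, which fails exactly for the identically zero process: there the
  integrand is \<open>1 / 0\<close>, and the dimension formula has no meaning.
\<close>

definition theta_index :: "real \<Rightarrow> (real \<Rightarrow> real) \<Rightarrow> ereal" where
  "theta_index s \<Phi> =
     Liminf at_top (\<lambda>l::real. ereal (1 / ln l * ln (LBINT x:{1..l}. 1 / \<Phi> (x powr (1 / s)))))"

end

theory Submission
  imports Defs
begin

text \<open>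
  Both bounds compare the profile of the range at scale \<open>r\<close> with the mean potential
  \<open>a(r) = E (\<integral> u in 0..1. (1 + S(u)/r) powr (-s))\<close>. The function \<open>d \<mapsto> (1 + d/r) powr (-s)\<close> agrees
  with the profile kernel up to a factor \<open>2 powr s\<close>, and it is a constant multiple of the mixture
  \<open>r powr s * (\<integral> x in 0..\<infinity>. exp (- x powr (1/s) * (r + d)))\<close> of exponentials. Expectations of
  exponentials are given by \<open>\<Phi>\<close>, and monotonicity of \<open>\<Phi>\<close> turns the resulting integral into
  \<open>r powr s * (\<integral> x in 1..r powr (-s). 1 / \<Phi> (x powr (1/s)))\<close>, up to constant factors
  (\<open>mean_potential_eq\<close>, \<open>mean_potential_bounds\<close>). Put \<open>l = r powr (-s)\<close>: the number
  \<open>L = s * (1 - \<theta>)\<close> is the critical exponent in the sense that \<open>r powr (-t) * a(r)\<close> tends to \<open>0\<close> along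
  some sequence \<open>r \<rightarrow> 0\<close> if \<open>t < L\<close>, whereas \<open>a(r)\<close> is eventually larger than a power \<open>r powr t'\<close>
  with \<open>t' < t\<close> if \<open>t > L\<close>.

  Lower bound. Let \<open>t < L\<close>, and choose radii along which \<open>r powr (-t) * a(r)\<close> is summable. By
  stationarity of the increments, the expected energy of the occupation measure of the path on
  \<open>[0, 1]\<close> is at most \<open>2 * a(r)\<close>, so almost surely the potentials of that measure, multiplied by
  \<open>r powr (-t)\<close>, are summable along these radii at almost every point. The range need not be closed,
  so the measure is first restricted to the image of a compact set of times at which the path is
  continuous; this only decreases potentials.

  Upper bound. Let \<open>t > L\<close>. A maximum principle shows that the set where the potential of a measure
  \<open>\<mu>\<close> is at most \<open>r powr t\<close> has \<open>\<mu>\<close>-measure at most \<open>4 powr s * r powr t\<close> times the mass of any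
  discrete measure whose potential is at least \<open>1\<close> on an \<open>r\<close>-net of the range
  (\<open>measure_low_density_le\<close>). Hence a discrete measure is needed that has small mass and works for all
  \<open>\<mu>\<close> simultaneously. The occupation measure does not serve this purpose: it may charge too little
  near exceptional points of the range. Instead, sample the path at the times \<open>k/N\<close> and choose weights
  recursively such that the potential which each sample point receives from itself and its
  predecessors equals \<open>1\<close>. Since the kernel decreases and the path increases, the weights are
  nonnegative; and the weight at time \<open>k/N\<close> depends only on the path before that time. By the
  Markov property, each unit of weight creates a total potential of at least \<open>N * a(r)\<close>, in
  expectation, at the next \<open>N\<close> sample points. As the total potential at the first \<open>2 * N\<close> sample
  points is \<open>2 * N\<close>, the expected weight of the first \<open>N + 1\<close> points is at most \<open>2 / a(r)\<close>
  (\<open>expected_grid_weight\<close>). Letting \<open>N \<rightarrow> \<infinity>\<close> by Fatou's lemma, and summing over the scales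
  \<open>r = (1/2) ^ n\<close>, the Borel--Cantelli lemma for \<open>\<mu>\<close> shows that \<open>\<mu>\<close>-almost every potential is
  eventually larger than \<open>r powr t\<close>.
\<close>

section \<open>The kernel of the dimension profile\<close>

text \<open>
  Up to a factor \<open>2 powr s\<close> this is the profile kernel at distance \<open>d\<close>; unlike the latter it is
  a mixture of the functions \<open>d \<mapsto> exp (- c * d)\<close>, so that its expectation along a subordinator
  is computable.
\<close>

definition smooth_kernel :: "real \<Rightarrow> real \<Rightarrow> real \<Rightarrow> real" where
  "smooth_kernel s r d = (1 + d / r) powr (- s)"

lemma smooth_kernel_measurable [measurable]: "smooth_kernel s r \<in> borel_measurable borel"
  unfolding smooth_kernel_def by measurable

lemma smooth_kernel_nonneg [simp]: "0 \<le> smooth_kernel s r d"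
  by (simp add: smooth_kernel_def)

lemma smooth_kernel_0 [simp]: "smooth_kernel s r 0 = 1"
  by (simp add: smooth_kernel_def)

lemma smooth_kernel_antimono:
  assumes "0 < s" "0 < r" "0 \<le> d" "d \<le> d'"
  shows "smooth_kernel s r d' \<le> smooth_kernel s r d"
  unfolding smooth_kernel_def
  by (intro powr_mono2') (use assms in \<open>auto intro!: divide_right_mono add_pos_nonneg\<close>)

lemma smooth_kernel_le_1:
  assumes "0 < s" "0 < r" "0 \<le> d"
  shows "smooth_kernel s r d \<le> 1"
  using smooth_kernel_antimono[of s r 0 d] assms by simp

text \<open>
  A Harnack inequality: moving a point by at most \<open>r\<close>, or doubling its distance, changes the
  kernel by a bounded factor. It follows from \<open>1 + d / r \<le> 2 * (1 + d' / r)\<close>.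
\<close>

lemma smooth_kernel_shift:
  assumes "0 < s" "0 < r" "0 \<le> d" "0 \<le> d'" "d \<le> 2 * d' + r"
  shows "smooth_kernel s r d' \<le> 2 powr s * smooth_kernel s r d"
proof -
  have pos: "0 < 1 + d / r" "0 < 1 + d' / r"
    using assms by (auto intro!: add_pos_nonneg)
  have "1 + d / r \<le> 2 * (1 + d' / r)"
    using divide_right_mono[OF assms(5), of r] assms(2) by (simp add: add_divide_distrib)
  then have "(2 * (1 + d' / r)) powr (- s) \<le> (1 + d / r) powr (- s)"
    using assms pos by (intro powr_mono2') auto
  then have "2 powr s * (2 * (1 + d' / r)) powr (- s) \<le> 2 powr s * (1 + d / r) powr (- s)"
    by simp
  moreover have "2 powr s * (2 * (1 + d' / r)) powr (- s) = (1 + d' / r) powr (- s)"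
    using pos by (subst powr_mult) (auto simp: powr_minus field_simps)
  ultimately show ?thesis by (simp only: smooth_kernel_def)
qed

definition profile_integrand :: "real \<Rightarrow> real \<Rightarrow> real \<Rightarrow> real \<Rightarrow> real" where
  "profile_integrand s r x y = (if y = x then 1 else min 1 (r powr s / \<bar>y - x\<bar> powr s))"

lemma profile_kernel_eq: "profile_kernel s \<mu> x r = (\<integral>y. profile_integrand s r x y \<partial>\<mu>)"
  by (simp add: profile_kernel_def profile_integrand_def)

lemma profile_integrand_measurable [measurable]:
  "(\<lambda>(x, y). profile_integrand s r x y) \<in> borel_measurable (borel \<Otimes>\<^sub>M borel)"
  unfolding profile_integrand_def by measurable

lemma profile_integrand_measurable' [measurable]:
  "profile_integrand s r x \<in> borel_measurable borel"
  unfolding profile_integrand_def by measurable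

lemma profile_integrand_nonneg [simp]: "0 \<le> profile_integrand s r x y"
  by (simp add: profile_integrand_def)

lemma profile_integrand_le_1 [simp]: "profile_integrand s r x y \<le> 1"
  by (simp add: profile_integrand_def)

lemma profile_integrand_mono:
  assumes "0 < s" "0 < r" "r \<le> r'"
  shows "profile_integrand s r x y \<le> profile_integrand s r' x y"
  unfolding profile_integrand_def
  using assms by (auto intro!: min.coboundedI2 divide_right_mono powr_mono2)

lemma smooth_kernel_le_profile_integrand:
  assumes "0 < s" "0 < r"
  shows "smooth_kernel s r \<bar>y - x\<bar> \<le> profile_integrand s r x y"
proof (cases "y = x")
  case False
  define d where "d = \<bar>y - x\<bar>"
  have d: "0 < d" using False by (simp add: d_def)
  have "(1 + d / r) powr (- s) \<le> (d / r) powr (- s)"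
    using d assms by (intro powr_mono2') auto
  also have "\<dots> = r powr s / d powr s"
    using d assms by (simp add: powr_divide powr_minus field_simps)
  finally have "(1 + d / r) powr (- s) \<le> r powr s / d powr s" .
  then show ?thesis
    using False smooth_kernel_le_1[of s r d] assms d
    by (simp add: profile_integrand_def smooth_kernel_def d_def)
qed (simp add: profile_integrand_def)

lemma profile_integrand_le_smooth_kernel:
  assumes "0 < s" "0 < r"
  shows "profile_integrand s r x y \<le> 2 powr s * smooth_kernel s r \<bar>y - x\<bar>"
proof (cases "\<bar>y - x\<bar> \<le> r")
  case True
  have "1 \<le> 2 powr s * smooth_kernel s r \<bar>y - x\<bar>"
    using smooth_kernel_shift[of s r "\<bar>y - x\<bar>" 0] assms True by simp
  then show ?thesis using profile_integrand_le_1 order_trans by blast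
next
  case False
  define d where "d = \<bar>y - x\<bar>"
  have d: "r < d" using False by (simp add: d_def)
  have "profile_integrand s r x y \<le> r powr s / d powr s"
    using d assms by (auto simp: profile_integrand_def d_def)
  also have "\<dots> = 2 powr s * (2 * (d / r)) powr (- s)"
    using d assms by (simp add: powr_divide powr_mult powr_minus field_simps)
  also have "\<dots> \<le> 2 powr s * (1 + d / r) powr (- s)"
    using d assms by (intro mult_left_mono powr_mono2') (auto simp: field_simps intro!: add_pos_pos)
  finally show ?thesis by (simp add: smooth_kernel_def d_def)
qed

lemma integrable_profile_integrand:
  assumes "finite_measure \<mu>" "sets \<mu> = sets borel"
  shows "integrable \<mu> (profile_integrand s r x)"
proof -
  interpret finite_measure \<mu> by fact
  have [measurable_cong]: "sets \<mu> = sets borel" by fact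
  show ?thesis
    by (rule integrable_const_bound[where B = 1]) auto
qed

lemma profile_kernel_measurable:
  assumes "finite_measure \<mu>" "sets \<mu> = sets borel"
  shows "(\<lambda>x. profile_kernel s \<mu> x r) \<in> borel_measurable borel"
proof -
  interpret finite_measure \<mu> by fact
  have [measurable_cong]: "sets \<mu> = sets borel" by fact
  show ?thesis unfolding profile_kernel_eq by measurable
qed

lemma profile_kernel_nonneg [simp]: "0 \<le> profile_kernel s \<mu> x r"
  unfolding profile_kernel_eq by simp

lemma profile_kernel_mono:
  assumes "finite_measure \<mu>" "sets \<mu> = sets borel" "0 < s" "0 < r" "r \<le> r'"
  shows "profile_kernel s \<mu> x r \<le> profile_kernel s \<mu> x r'"
  unfolding profile_kernel_eq
  by (intro integral_mono integrable_profile_integrand profile_integrand_mono assms)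

lemma ennreal_profile_kernel:
  assumes "finite_measure \<mu>" "sets \<mu> = sets borel"
  shows "ennreal (profile_kernel s \<mu> x r) = (\<integral>\<^sup>+y. profile_integrand s r x y \<partial>\<mu>)"
  unfolding profile_kernel_eq
  by (rule nn_integral_eq_integral[symmetric]) (auto intro!: integrable_profile_integrand assms)

section \<open>Equilibrium weights of an increasing sequence\<close>

text \<open>
  The recursion solves the triangular linear system which says that the potential at \<open>y k\<close> of
  the point masses at \<open>y 0, \<dots>, y k\<close> equals \<open>1\<close>. If \<open>\<phi>\<close> is the renewal function of a stationary
  regenerative set, the weight is, up to normalization, the probability that \<open>y k\<close> is the first
  of these points which belongs to the set.
\<close>

function first_hit_weight :: "(real \<Rightarrow> real) \<Rightarrow> (nat \<Rightarrow> real) \<Rightarrow> nat \<Rightarrow> real" where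
  "first_hit_weight \<phi> y k = 1 - (\<Sum>j<k. \<phi> (y k - y j) * first_hit_weight \<phi> y j)"
  by pat_completeness auto
termination by (relation "Wellfounded.measure (\<lambda>(\<phi>, y, k). k)") auto

declare first_hit_weight.simps [simp del]

lemma first_hit_weight_potential:
  assumes "\<phi> 0 = 1"
  shows "(\<Sum>j\<le>k. \<phi> (y k - y j) * first_hit_weight \<phi> y j) = 1"
proof -
  have "{..k} = insert k {..<k}" by auto
  then show ?thesis using assms by (simp add: first_hit_weight.simps[of \<phi> y k])
qed

text \<open>
  By monotonicity of \<open>\<phi>\<close> and \<open>y\<close>, the masses at \<open>y 0, \<dots>, y i\<close> have at \<open>y (Suc i)\<close> at most the
  potential that they have at \<open>y i\<close>. The latter is \<open>1\<close>, so the mass still missing at \<open>y (Suc i)\<close>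
  is nonnegative.
\<close>

lemma first_hit_weight_nonneg:
  assumes "\<phi> 0 = 1" and anti: "\<And>d d'. 0 \<le> d \<Longrightarrow> d \<le> d' \<Longrightarrow> \<phi> d' \<le> \<phi> d"
    and y: "mono y"
  shows "0 \<le> first_hit_weight \<phi> y k"
proof (induction k rule: less_induct)
  case (less k)
  show ?case
  proof (cases k)
    case 0
    then show ?thesis by (simp add: first_hit_weight.simps[of \<phi> y 0])
  next
    case (Suc i)
    have "(\<Sum>j<k. \<phi> (y k - y j) * first_hit_weight \<phi> y j)
        \<le> (\<Sum>j<k. \<phi> (y i - y j) * first_hit_weight \<phi> y j)"
      using less y by (intro sum_mono mult_right_mono anti) (auto simp: Suc mono_def)
    also have "\<dots> = 1"
      using first_hit_weight_potential[of \<phi> y i] assms(1) by (simp add: Suc lessThan_Suc_atMost)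
    finally show ?thesis by (simp add: first_hit_weight.simps[of \<phi> y k])
  qed
qed

lemma first_hit_weight_cong:
  assumes "\<And>i. i \<le> k \<Longrightarrow> y i = z i"
  shows "first_hit_weight \<phi> y k = first_hit_weight \<phi> z k"
  using assms
proof (induction k rule: less_induct)
  case (less k)
  then show ?case
    by (subst (1 2) first_hit_weight.simps) (auto intro!: sum.cong)
qed

lemma first_hit_weight_measurable:
  assumes [measurable]: "\<phi> \<in> borel_measurable borel"
    and y [measurable]: "\<And>i. i \<le> k \<Longrightarrow> (\<lambda>\<omega>. y \<omega> i) \<in> borel_measurable N"
  shows "(\<lambda>\<omega>. first_hit_weight \<phi> (y \<omega>) k) \<in> borel_measurable N"
  using y
proof (induction k rule: less_induct)
  case (less k)
  have "(\<lambda>\<omega>. \<phi> (y \<omega> k - y \<omega> j) * first_hit_weight \<phi> (y \<omega>) j) \<in> borel_measurable N" if "j < k" for j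
  proof -
    have [measurable]: "(\<lambda>\<omega>. y \<omega> k) \<in> borel_measurable N" "(\<lambda>\<omega>. y \<omega> j) \<in> borel_measurable N"
      using less.prems that by auto
    have [measurable]: "(\<lambda>\<omega>. first_hit_weight \<phi> (y \<omega>) j) \<in> borel_measurable N"
      using less that by auto
    show ?thesis by measurable
  qed
  then show ?case by (subst first_hit_weight.simps) auto
qed

text \<open>
  A duality argument, with \<open>m\<close> as the test measure. The part of \<open>\<mu>\<close> on \<open>A\<close> has potential at most
  \<open>2 powr s * b\<close> at every point, and not only on \<open>A\<close>: compare any point with a nearly closest
  point of \<open>A\<close> (maximum principle). Integrate the potential of \<open>m\<close>, which is at least
  \<open>2 powr (- s)\<close> on \<open>A\<close> because the \<open>y i\<close> form an \<open>r\<close>-net, with respect to that part of \<open>\<mu>\<close>, and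
  exchange the order of integration.
\<close>

lemma measure_low_density_le:
  assumes fin: "finite_measure \<mu>" and sets: "sets \<mu> = sets borel"
    and s: "0 < s" and r: "0 < r"
    and net: "\<And>x. x \<in> F \<Longrightarrow> \<exists>i\<le>N. \<bar>x - y i\<bar> \<le> r"
    and m: "\<And>j. j \<le> N \<Longrightarrow> 0 \<le> m j"
    and potential: "\<And>i. i \<le> N \<Longrightarrow> 1 \<le> (\<Sum>j\<le>N. smooth_kernel s r \<bar>y i - y j\<bar> * m j)"
    and A: "A \<in> sets borel" "A \<subseteq> F"
    and low: "\<And>x. x \<in> A \<Longrightarrow> profile_kernel s \<mu> x r \<le> b" and b: "0 \<le> b"
  shows "measure \<mu> A \<le> 4 powr s * b * (\<Sum>j\<le>N. m j)"
proof (cases "A = {}")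
  case True
  then show ?thesis using b m by (auto intro!: mult_nonneg_nonneg sum_nonneg)
next
  case False
  interpret finite_measure \<mu> by fact
  have [measurable_cong]: "sets \<mu> = sets borel" by fact
  have [measurable]: "A \<in> sets borel" by fact
  let ?\<phi> = "smooth_kernel s r"
  have int: "integrable \<mu> (\<lambda>x. indicator A x * ?\<phi> \<bar>x - v\<bar>)" for v
    by (rule integrable_const_bound[where B = 1])
       (auto simp: indicator_def smooth_kernel_le_1 s r)
  have pot: "(\<integral>x. indicator A x * ?\<phi> \<bar>x - v\<bar> \<partial>\<mu>) \<le> 2 powr s * b" for v
  proof -
    (* The set A need not be closed; a point whose distance from v is within r of the minimal one
       suffices. *)
    define D where "D = Inf ((\<lambda>x. \<bar>x - v\<bar>) ` A)"
    have bdd: "bdd_below ((\<lambda>x. \<bar>x - v\<bar>) ` A)" by (rule bdd_belowI[where m = 0]) auto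
    have "\<exists>d\<in>(\<lambda>x. \<bar>x - v\<bar>) ` A. d < D + r"
      unfolding D_def using False r bdd by (subst cInf_less_iff[symmetric]) auto
    then obtain x where x: "x \<in> A" "\<bar>x - v\<bar> < D + r" by auto
    have D: "D \<le> \<bar>z - v\<bar>" if "z \<in> A" for z
      unfolding D_def using that bdd by (intro cInf_lower) auto
    have "indicator A z * ?\<phi> \<bar>z - v\<bar> \<le> 2 powr s * profile_integrand s r x z" for z
    proof (cases "z \<in> A")
      case True
      have "\<bar>z - x\<bar> \<le> 2 * \<bar>z - v\<bar> + r" 
        using D[OF True] x(2) abs_triangle_ineq4[of "z - v" "x - v"] by simp
      then have "?\<phi> \<bar>z - v\<bar> \<le> 2 powr s * ?\<phi> \<bar>z - x\<bar>"
        using s r by (intro smooth_kernel_shift) auto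
      also have "\<dots> \<le> 2 powr s * profile_integrand s r x z"
        using s r by (intro mult_left_mono smooth_kernel_le_profile_integrand) auto
      finally show ?thesis using True by simp
    qed simp
    then have "(\<integral>z. indicator A z * ?\<phi> \<bar>z - v\<bar> \<partial>\<mu>) \<le> (\<integral>z. 2 powr s * profile_integrand s r x z \<partial>\<mu>)"
      by (intro integral_mono int integrable_mult_right integrable_profile_integrand fin sets)
    also have "\<dots> = 2 powr s * profile_kernel s \<mu> x r" by (simp add: profile_kernel_eq)
    also have "\<dots> \<le> 2 powr s * b" using low[OF x(1)] by simp
    finally show ?thesis .
  qed
  have below: "indicator A x \<le> 2 powr s * (\<Sum>j\<le>N. m j * (indicator A x * ?\<phi> \<bar>x - y j\<bar>))" for x :: real
  proof (cases "x \<in> A")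
    case True
    then obtain i where i: "i \<le> N" "\<bar>x - y i\<bar> \<le> r" using net A by blast
    have "1 \<le> (\<Sum>j\<le>N. ?\<phi> \<bar>y i - y j\<bar> * m j)" using potential i by simp
    also have "\<dots> \<le> (\<Sum>j\<le>N. (2 powr s * ?\<phi> \<bar>x - y j\<bar>) * m j)"
    proof (intro sum_mono mult_right_mono smooth_kernel_shift)
      fix j show "\<bar>x - y j\<bar> \<le> 2 * \<bar>y i - y j\<bar> + r" 
        using i(2) abs_triangle_ineq[of "x - y i" "y i - y j"] by (smt (verit))
    qed (use m s r in auto)
    finally show ?thesis using True by (simp add: sum_distrib_left mult_ac)
  qed simp
  have "measure \<mu> A = (\<integral>x. indicator A x \<partial>\<mu>)" by simp
  also have "\<dots> \<le> (\<integral>x. 2 powr s * (\<Sum>j\<le>N. m j * (indicator A x * ?\<phi> \<bar>x - y j\<bar>)) \<partial>\<mu>)"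
    by (intro integral_mono below integrable_mult_right Bochner_Integration.integrable_sum int)
       (simp add: integrable_real_indicator emeasure_eq_measure)
  also have "\<dots> = 2 powr s * (\<Sum>j\<le>N. m j * (\<integral>x. indicator A x * ?\<phi> \<bar>x - y j\<bar> \<partial>\<mu>))"
    using int by (subst integral_mult_right_zero, subst Bochner_Integration.integral_sum) auto
  also have "\<dots> \<le> 2 powr s * (\<Sum>j\<le>N. m j * (2 powr s * b))"
    by (intro mult_left_mono sum_mono pot) (auto simp: m)
  also have "\<dots> = (2 powr s * 2 powr s) * b * (\<Sum>j\<le>N. m j)"
    by (simp flip: sum_distrib_right)
  also have "2 powr s * 2 powr s = (4 powr s :: real)"
    by (simp flip: powr_mult)
  finally show ?thesis .
qed

section \<open>Supports and lower limits\<close>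

lemma closed_measure_support: "closed (measure_support \<mu>)"
proof -
  have "- measure_support \<mu> = \<Union>{U. open U \<and> emeasure \<mu> U = 0}"
    by (auto simp: measure_support_def)
  then show ?thesis unfolding closed_def by auto
qed

lemma emeasure_compl_measure_support:
  assumes "sets \<mu> = sets borel"
  shows "emeasure \<mu> (- measure_support \<mu>) = 0"
proof -
  let ?U = "{U. open U \<and> emeasure \<mu> U = 0}"
  obtain \<C> where \<C>: "\<C> \<subseteq> ?U" "countable \<C>" "\<Union>\<C> = \<Union>?U"
    using Lindelof[of ?U] by blast
  have "(\<Union>U\<in>\<C>. U) \<in> null_sets \<mu>"
    using \<C> assms by (intro null_sets_UN') (auto simp: null_sets_def)
  then have "emeasure \<mu> (\<Union>\<C>) = 0" by (auto simp: null_sets_def)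
  moreover have "- measure_support \<mu> = \<Union>?U"
    by (auto simp: measure_support_def)
  ultimately show ?thesis using \<C>(3) by simp
qed

text \<open>
  The profile kernel increases with the radius, so between two consecutive powers of \<open>1/2\<close> it is
  bounded below by its value at the smaller one; this costs only the factor \<open>(1/2) powr t\<close>.
\<close>

lemma Liminf_profile_pos:
  assumes fin: "finite_measure \<mu>" "sets \<mu> = sets borel" and s: "0 < s" and t: "0 < t" "t \<le> t'"
    and ev: "\<forall>\<^sub>F n in sequentially. ((1 / 2) ^ n) powr t < profile_kernel s \<mu> x ((1 / 2) ^ n)"
  shows "0 < Liminf (at_right 0) (\<lambda>r. ereal (r powr (- t') * profile_kernel s \<mu> x r))"
proof -
  obtain n0 where n0: "\<And>n. n0 \<le> n \<Longrightarrow> ((1 / 2) ^ n) powr t < profile_kernel s \<mu> x ((1 / 2) ^ n)"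
    using ev by (auto simp: eventually_sequentially)
  have "(1 / 2) powr t \<le> r powr (- t') * profile_kernel s \<mu> x r"
    if r: "0 < r" "r < (1 / 2) ^ n0" for r :: real
  proof -
    obtain k where "(1 / 2 :: real) ^ k < r" using real_arch_pow_inv[of r "1 / 2"] r by auto
    (* The largest power of 1/2 that does not exceed r. *)
    define n where "n = (LEAST n. (1 / 2 :: real) ^ n \<le> r)"
    have n: "(1 / 2 :: real) ^ n \<le> r"
      unfolding n_def using \<open>(1 / 2) ^ k < r\<close> by (intro LeastI[of "\<lambda>n. (1 / 2 :: real) ^ n \<le> r" k]) simp
    have "n0 < n"
    proof (rule ccontr)
      assume "\<not> n0 < n"
      then have "(1 / 2 :: real) ^ n0 \<le> (1 / 2) ^ n" by (intro power_decreasing) auto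
      then show False using n r by linarith
    qed
    then obtain m where m: "n = Suc m" "n0 \<le> m" by (cases n) auto
    have "m < n" by (simp add: m(1))
    then have "\<not> (1 / 2 :: real) ^ m \<le> r" unfolding n_def by (rule not_less_Least)
    then have rm: "r < (1 / 2) ^ m" by simp
    have "(1 / 2 :: real) ^ m \<le> 1" by (intro power_le_one) auto
    then have r1: "r < 1" using rm by linarith
    have "((1 / 2 :: real) ^ n) powr t = (1 / 2) powr t * ((1 / 2) ^ m) powr t"
      unfolding m(1) power_Suc by (rule powr_mult)
    then have "(1 / 2) powr t = ((1 / 2) ^ m) powr (- t) * ((1 / 2) ^ n) powr t"
      by (simp add: powr_minus)
    also have "\<dots> \<le> r powr (- t) * profile_kernel s \<mu> x ((1 / 2) ^ n)"
      using n0[of n] m rm r t by (intro mult_mono powr_mono2') auto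
    also have "\<dots> \<le> r powr (- t') * profile_kernel s \<mu> x r"
      using r r1 t by (intro mult_mono powr_mono' profile_kernel_mono fin s n) auto
    finally show ?thesis .
  qed
  then have "\<forall>\<^sub>F r in at_right 0. ereal ((1 / 2) powr t) \<le> ereal (r powr (- t') * profile_kernel s \<mu> x r)"
    by (auto simp: eventually_at_right[of 0 "(1 / 2) ^ n0"] intro!: exI[of _ "(1 / 2) ^ n0"])
  then have "ereal ((1 / 2) powr t) \<le> Liminf (at_right 0) (\<lambda>r. ereal (r powr (- t') * profile_kernel s \<mu> x r))"
    by (rule Liminf_bounded)
  moreover have "0 < ereal ((1 / 2) powr t)" by simp
  ultimately show ?thesis by (rule less_le_trans[rotated])
qed

lemma Liminf_profile_eq_0:
  assumes r: "\<And>n. 0 < r n" "r \<longlonglongrightarrow> 0"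
    and fin: "(\<Sum>n. ennreal (r n powr (- t) * profile_kernel s \<mu> x (r n))) < \<infinity>"
  shows "Liminf (at_right 0) (\<lambda>r. ereal (r powr (- t) * profile_kernel s \<mu> x r)) = 0"
proof (rule antisym)
  let ?f = "\<lambda>r. r powr (- t) * profile_kernel s \<mu> x r"
  show "0 \<le> Liminf (at_right 0) (\<lambda>r. ereal (?f r))"
    by (intro Liminf_bounded always_eventually) simp
  have "summable (\<lambda>n. ?f (r n))"
    using fin by (intro summable_suminf_not_top) auto
  then have lim: "(\<lambda>n. ?f (r n)) \<longlonglongrightarrow> 0" by (rule summable_LIMSEQ_zero)
  show "Liminf (at_right 0) (\<lambda>r. ereal (?f r)) \<le> 0"
  proof (rule ccontr)
    assume "\<not> ?thesis"
    then obtain c where c: "0 < ereal c" "ereal c < Liminf (at_right 0) (\<lambda>r. ereal (?f r))"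
      using ereal_dense2[of 0 "Liminf (at_right 0) (\<lambda>r. ereal (?f r))"] by (auto simp: not_le)
    have "filterlim r (at_right 0) sequentially"
      using r by (auto simp: filterlim_at intro!: always_eventually less_imp_neq[THEN not_sym])
    then have "\<forall>\<^sub>F n in sequentially. c < ?f (r n)"
      using eventually_compose_filterlim[OF less_LiminfD[OF c(2)]] by simp
    moreover have "\<forall>\<^sub>F n in sequentially. ?f (r n) < c"
      using lim c(1) by (intro order_tendstoD) auto
    ultimately have "\<forall>\<^sub>F n::nat in sequentially. False" by eventually_elim simp
    then show False by simp
  qed
qed

section \<open>Mixtures of exponentials\<close>

text \<open>
  This is \<open>Gamma (s + 1)\<close>; only its being finite and positive matters. In the variable \<open>x\<close> of
  this form all later changes of variables are linear, and the integrand
  \<open>1 / \<Phi> (x powr (1 / s))\<close> of the index appears directly.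
\<close>

definition stretch_integral :: "real \<Rightarrow> ennreal" where
  "stretch_integral s = (\<integral>\<^sup>+x. indicator {0<..} x * ennreal (exp (- (x powr (1 / s)))) \<partial>lborel)"

text \<open>
  The integrand decays at least like a multiple of \<open>x powr (- 2)\<close>: raise
  \<open>z / (2 * s) \<le> exp (z / (2 * s))\<close> with \<open>z = x powr (1 / s)\<close> to the power \<open>2 * s\<close>.
\<close>

lemma stretch_integral_finite:
  assumes s: "0 < s"
  shows "stretch_integral s < \<infinity>"
proof -
  let ?K = "(2 * s) powr (2 * s)"
  have bound: "exp (- (x powr (1 / s))) \<le> ?K * x powr (- 2)" if "1 \<le> x" for x
  proof -
    define z where "z = x powr (1 / s)"
    have z: "0 < z" using that by (simp add: z_def)
    have "(z / (2 * s)) powr (2 * s) \<le> exp (z / (2 * s)) powr (2 * s)"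
      using z s exp_ge_add_one_self[of "z / (2 * s)"]
      by (intro powr_mono2) (auto simp del: exp_ge_add_one_self)
    also have "\<dots> = exp z" using s by (simp add: exp_powr_real)
    also have "(z / (2 * s)) powr (2 * s) = x powr 2 / ?K"
      using that s z by (simp add: powr_divide z_def powr_powr)
    finally have "x powr 2 / ?K \<le> exp z" .
    then have "x powr 2 \<le> ?K * exp z" using s by (simp add: divide_le_eq mult.commute)
    then show ?thesis using that s
      by (simp add: exp_minus powr_minus z_def field_simps)
  qed
  have "stretch_integral s \<le> (\<integral>\<^sup>+x. indicator {0..1} x + ennreal (?K * x powr (- 2)) * indicator {1..} x \<partial>lborel)"
    unfolding stretch_integral_def
  proof (intro nn_integral_mono)
    fix x :: real
    consider "x \<le> 0" | "0 < x" "x \<le> 1" | "1 < x" by linarith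
    then show "indicator {0<..} x * ennreal (exp (- (x powr (1 / s))))
        \<le> indicator {0..1} x + ennreal (?K * x powr (- 2)) * indicator {1..} x"
    proof cases
      case 2
      then have "ennreal (exp (- (x powr (1 / s)))) \<le> 1 + ennreal (?K * x powr (- 2)) * indicator {1..} x"
        by (intro add_increasing2) auto
      then show ?thesis using 2 by simp
    qed (use bound[of x] in \<open>auto intro!: ennreal_leI\<close>)
  qed
  also have "\<dots> = (\<integral>\<^sup>+x. indicator {0..1::real} x \<partial>lborel)
      + (\<integral>\<^sup>+x. ennreal (?K * x powr (- 2)) * indicator {1..} x \<partial>lborel)"
    by (rule nn_integral_add) auto
  also have "(\<integral>\<^sup>+x. ennreal (?K * x powr (- 2)) * indicator {1..} x \<partial>lborel) = ennreal (0 - - (?K * 1 powr (- 1)))"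
  proof (rule nn_integral_FTC_atLeast[where F = "\<lambda>x. - (?K * x powr (- 1))"])
    show "((\<lambda>x. - (?K * x powr (- 1))) has_real_derivative ?K * x powr (- 2)) (at x)" if "1 \<le> x" for x
      using that DERIV_cmult[OF has_real_derivative_powr[of x "- 1"], of "- ?K"] by simp
    show "((\<lambda>x::real. - (?K * x powr (- 1))) \<longlongrightarrow> 0) at_top"
      by (rule tendsto_eq_intros tendsto_neg_powr filterlim_ident | simp)+
  qed auto
  also have "(\<integral>\<^sup>+x. indicator {0..1::real} x \<partial>lborel) + ennreal (0 - - (?K * 1 powr (- 1))) < \<infinity>"
    by simp
  finally show ?thesis .
qed

lemma stretch_integral_pos:
  assumes s: "0 < s"
  shows "0 < stretch_integral s"
proof -
  have "(\<integral>\<^sup>+x. indicator {0<..1::real} x * ennreal (exp (- 1)) \<partial>lborel) \<le> stretch_integral s"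
    unfolding stretch_integral_def
  proof (intro nn_integral_mono)
    fix x :: real
    have "x powr (1 / s) \<le> 1" if "0 < x" "x \<le> 1"
      using that s by (intro powr_le1) auto
    then show "indicator {0<..1} x * ennreal (exp (- 1))
        \<le> indicator {0<..} x * ennreal (exp (- (x powr (1 / s))))"
      by (auto simp: indicator_def)
  qed
  moreover have "(\<integral>\<^sup>+x. indicator {0<..1::real} x * ennreal (exp (- 1)) \<partial>lborel) = ennreal (exp (- 1))"
    by (simp add: nn_integral_multc)
  moreover have "0 < ennreal (exp (- 1))" by simp
  ultimately show ?thesis by (metis less_le_trans)
qed

lemma stretch_integral_scale:
  assumes s: "0 < s" and a: "0 < a"
  shows "(\<integral>\<^sup>+x. indicator {0<..} x * ennreal (exp (- (x powr (1 / s) * a))) \<partial>lborel)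
    = ennreal (a powr (- s)) * stretch_integral s"
proof -
  have "stretch_integral s
      = ennreal (a powr s) * (\<integral>\<^sup>+x. indicator {0<..} (0 + a powr s * x)
          * ennreal (exp (- ((0 + a powr s * x) powr (1 / s)))) \<partial>lborel)"
    unfolding stretch_integral_def
    using a by (subst nn_integral_real_affine[where t = 0 and c = "a powr s"]) auto
  also have "(\<integral>\<^sup>+x. indicator {0<..} (0 + a powr s * x)
          * ennreal (exp (- ((0 + a powr s * x) powr (1 / s)))) \<partial>lborel)
      = (\<integral>\<^sup>+x. indicator {0<..} x * ennreal (exp (- (x powr (1 / s) * a))) \<partial>lborel)"
    using a s
    by (intro nn_integral_cong)
       (auto simp: indicator_def zero_less_mult_iff powr_mult powr_powr mult.commute)
  finally have "ennreal (a powr (- s)) * stretch_integral s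
      = (ennreal (a powr (- s)) * ennreal (a powr s))
        * (\<integral>\<^sup>+x. indicator {0<..} x * ennreal (exp (- (x powr (1 / s) * a))) \<partial>lborel)"
    by (simp add: mult.assoc)
  also have "ennreal (a powr (- s)) * ennreal (a powr s) = 1"
    using a by (simp flip: ennreal_mult' powr_add)
  finally show ?thesis by simp
qed

text \<open>
  The kernel as a mixture of exponentials of \<open>d\<close>; this is the scaling identity for the factor
  \<open>r + d\<close>.
\<close>

lemma smooth_kernel_stretch:
  assumes s: "0 < s" and r: "0 < r" and d: "0 \<le> d"
  shows "stretch_integral s * ennreal (smooth_kernel s r d)
    = ennreal (r powr s) * (\<integral>\<^sup>+x. indicator {0<..} x * ennreal (exp (- (x powr (1 / s) * (r + d)))) \<partial>lborel)"
proof -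
  have "smooth_kernel s r d = ((r + d) / r) powr (- s)"
    using r by (simp add: smooth_kernel_def add_divide_distrib)
  also have "\<dots> = r powr s * (r + d) powr (- s)"
    using r d by (simp add: powr_divide powr_minus field_simps)
  finally show ?thesis
    using r d s stretch_integral_scale[of s "r + d"] by (simp only:) (simp add: ennreal_mult' ac_simps)
qed

lemma nn_integral_exp_unit:
  assumes "0 < (\<psi>::real)"
  shows "(\<integral>\<^sup>+u. indicator {0..1} u * ennreal (exp (- (u * \<psi>))) \<partial>lborel) = ennreal ((1 - exp (- \<psi>)) / \<psi>)"
proof -
  have "(\<integral>\<^sup>+u. ennreal (exp (- (u * \<psi>))) * indicator {0..1} u \<partial>lborel)
      = ennreal ((- exp (- (1 * \<psi>)) / \<psi>) - (- exp (- (0 * \<psi>)) / \<psi>))"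
    using assms by (intro nn_integral_FTC_Icc) (auto intro!: derivative_eq_intros)
  also have "(- exp (- (1 * \<psi>)) / \<psi>) - (- exp (- (0 * \<psi>)) / \<psi>) = (1 - exp (- \<psi>)) / \<psi>"
    by (simp add: diff_divide_distrib)
  finally show ?thesis by (simp add: mult.commute)
qed

text \<open>
  What remains of the expected kernel, integrated over the unit time interval, once the
  expectation of the exponentials has been replaced by \<open>exp (- u * \<Psi> y)\<close>. In the application,
  \<open>\<Psi> y\<close> is \<open>\<Phi> (y powr (1 / s))\<close>.
\<close>

definition smoothed_sojourn :: "real \<Rightarrow> (real \<Rightarrow> real) \<Rightarrow> real \<Rightarrow> ennreal" where
  "smoothed_sojourn s \<Psi> r = (\<integral>\<^sup>+y. indicator {0<..} y * (ennreal (exp (- (r * y powr (1 / s))))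
     * (\<integral>\<^sup>+u. indicator {0..1} u * ennreal (exp (- (u * \<Psi> y))) \<partial>lborel)) \<partial>lborel)"

definition inverse_integral :: "(real \<Rightarrow> real) \<Rightarrow> real \<Rightarrow> ennreal" where
  "inverse_integral \<Psi> l = (\<integral>\<^sup>+y. indicator {1..l} y * ennreal (1 / \<Psi> y) \<partial>lborel)"

context
  fixes \<Psi> :: "real \<Rightarrow> real" and s :: real
  assumes meas [measurable]: "\<Psi> \<in> borel_measurable borel"
    and pos: "\<And>y. 0 < y \<Longrightarrow> 0 < \<Psi> y"
    and mono: "\<And>y y'. 0 < y \<Longrightarrow> y \<le> y' \<Longrightarrow> \<Psi> y \<le> \<Psi> y'"
    and s: "0 < s"
begin

lemma inverse_integral_le:
  assumes "1 \<le> l"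
  shows "inverse_integral \<Psi> l \<le> ennreal (l / \<Psi> 1)"
proof -
  have "inverse_integral \<Psi> l \<le> (\<integral>\<^sup>+y. ennreal (1 / \<Psi> 1) * indicator {1..l} y \<partial>lborel)"
    unfolding inverse_integral_def using pos[of 1] mono[of 1]
    by (intro nn_integral_mono) (auto simp: indicator_def intro!: ennreal_leI divide_left_mono mult_pos_pos pos)
  also have "\<dots> = ennreal (1 / \<Psi> 1) * ennreal (l - 1)"
    using assms by (simp add: nn_integral_cmult)
  also have "\<dots> = ennreal ((l - 1) / \<Psi> 1)"
    using assms pos[of 1] by (simp flip: ennreal_mult')
  also have "\<dots> \<le> ennreal (l / \<Psi> 1)"
    using pos[of 1] by (intro ennreal_leI divide_right_mono) auto
  finally show ?thesis .
qed

lemma inverse_integral_ge: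
  assumes "1 \<le> l"
  shows "ennreal ((l - 1) / \<Psi> l) \<le> inverse_integral \<Psi> l"
proof -
  have "ennreal ((l - 1) / \<Psi> l) = ennreal (1 / \<Psi> l) * ennreal (l - 1)"
    using assms pos[of l] by (simp flip: ennreal_mult')
  also have "\<dots> = (\<integral>\<^sup>+y. ennreal (1 / \<Psi> l) * indicator {1..l} y \<partial>lborel)"
    using assms by (simp add: nn_integral_cmult)
  also have "\<dots> \<le> inverse_integral \<Psi> l"
    unfolding inverse_integral_def using pos[of l] mono[of _ l] assms
    by (intro nn_integral_mono) (auto simp: indicator_def intro!: ennreal_leI divide_left_mono mult_pos_pos pos)
  finally show ?thesis .
qed

lemma inverse_integral_mono: "l \<le> l' \<Longrightarrow> inverse_integral \<Psi> l \<le> inverse_integral \<Psi> l'"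
  unfolding inverse_integral_def
  by (intro nn_integral_mono mult_right_mono) (auto simp: indicator_def)

text \<open>
  For \<open>1 \<le> y \<le> r powr (- s)\<close> the exponential factor is at least \<open>exp (- 1)\<close>, and the inner
  integral \<open>(1 - exp (- \<Psi> y)) / \<Psi> y\<close> is comparable to \<open>1 / \<Psi> y\<close>.
\<close>

lemma smoothed_sojourn_ge:
  assumes r: "0 < r"
  shows "ennreal (exp (- 1) * (1 - exp (- \<Psi> 1))) * inverse_integral \<Psi> (r powr (- s)) \<le> smoothed_sojourn s \<Psi> r"
proof -
  let ?c = "exp (- 1) * (1 - exp (- \<Psi> 1))"
  have "ennreal ?c * inverse_integral \<Psi> (r powr (- s))
      = (\<integral>\<^sup>+y. ennreal ?c * (indicator {1..r powr (- s)} y * ennreal (1 / \<Psi> y)) \<partial>lborel)"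
    unfolding inverse_integral_def by (rule nn_integral_cmult[symmetric]) measurable
  also have "\<dots> \<le> smoothed_sojourn s \<Psi> r"
    unfolding smoothed_sojourn_def
  proof (intro nn_integral_mono)
    fix y :: real
    show "ennreal ?c * (indicator {1..r powr (- s)} y * ennreal (1 / \<Psi> y))
        \<le> indicator {0<..} y * (ennreal (exp (- (r * y powr (1 / s))))
          * (\<integral>\<^sup>+u. indicator {0..1} u * ennreal (exp (- (u * \<Psi> y))) \<partial>lborel))"
    proof (cases "y \<in> {1..r powr (- s)}")
      case True
      have "y powr (1 / s) \<le> (r powr (- s)) powr (1 / s)"
        using True s by (intro powr_mono2) auto
      also have "\<dots> = 1 / r"
        using r s by (simp only: powr_powr) (simp add: powr_minus divide_inverse)
      finally have "r * y powr (1 / s) \<le> 1" using r by (simp add: field_simps)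
      then have 1: "exp (- 1) \<le> exp (- (r * y powr (1 / s)))" by simp
      have 2: "1 - exp (- \<Psi> 1) \<le> 1 - exp (- \<Psi> y)" using mono[of 1 y] True by simp
      have 3: "0 \<le> 1 - exp (- \<Psi> 1)" using pos[of 1] by simp
      have 4: "0 < \<Psi> y" using True pos by simp
      have "?c * (1 / \<Psi> y) \<le> exp (- (r * y powr (1 / s))) * (1 - exp (- \<Psi> y)) * (1 / \<Psi> y)"
        using 1 2 3 4 by (intro mult_right_mono mult_mono) auto
      then have le: "ennreal (?c * (1 / \<Psi> y)) \<le> ennreal (exp (- (r * y powr (1 / s))) * ((1 - exp (- \<Psi> y)) / \<Psi> y))"
        by (intro ennreal_leI) simp
      have "ennreal (?c * (1 / \<Psi> y)) = ennreal ?c * ennreal (1 / \<Psi> y)"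
        using 3 4 by (intro ennreal_mult) auto
      moreover have "ennreal (exp (- (r * y powr (1 / s))) * ((1 - exp (- \<Psi> y)) / \<Psi> y))
          = ennreal (exp (- (r * y powr (1 / s)))) * ennreal ((1 - exp (- \<Psi> y)) / \<Psi> y)"
        using 4 by (intro ennreal_mult) auto
      ultimately show ?thesis
        using True 4 le by (simp add: nn_integral_exp_unit)
    qed simp
  qed
  finally show ?thesis .
qed

text \<open>
  Split at \<open>1\<close> and at \<open>l = r powr (- s)\<close>. The part below \<open>1\<close> is at most \<open>1\<close>; the middle part is
  at most the integral of \<open>1 / \<Psi>\<close>; beyond \<open>l\<close>, where \<open>1 / \<Psi> \<le> 1 / \<Psi> l\<close>, the exponential factor
  has integral at most \<open>l * stretch_integral s\<close>. As \<open>\<Psi>\<close> increases and \<open>l \<ge> 2\<close>, the first and the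
  last part are themselves bounded by multiples of the middle one.
\<close>

lemma smoothed_sojourn_le:
  assumes r: "0 < r" and l: "2 \<le> r powr (- s)"
  shows "smoothed_sojourn s \<Psi> r
    \<le> (ennreal (\<Psi> 2) + 1 + 2 * stretch_integral s) * inverse_integral \<Psi> (r powr (- s))"
proof -
  define l where "l = r powr (- s)"
  have l2: "2 \<le> l" using l by (simp add: l_def)
  let ?J = "inverse_integral \<Psi> l"
  let ?g = "\<lambda>y. ennreal (exp (- (y powr (1 / s) * r)))"
  have "smoothed_sojourn s \<Psi> r \<le> (\<integral>\<^sup>+y. indicator {0..1} y + indicator {1..l} y * ennreal (1 / \<Psi> y)
      + ennreal (1 / \<Psi> l) * (indicator {0<..} y * ?g y) \<partial>lborel)"
    unfolding smoothed_sojourn_def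
  proof (intro nn_integral_mono)
    fix y :: real
    let ?b = "\<integral>\<^sup>+u. indicator {0..1} u * ennreal (exp (- (u * \<Psi> y))) \<partial>lborel"
    show "indicator {0<..} y * (ennreal (exp (- (r * y powr (1 / s)))) * ?b)
      \<le> indicator {0..1} y + indicator {1..l} y * ennreal (1 / \<Psi> y)
        + ennreal (1 / \<Psi> l) * (indicator {0<..} y * ?g y)"
    proof (cases "0 < y")
      case True
      have \<Psi>: "0 < \<Psi> y" using pos True .
      have b: "?b \<le> ennreal (1 / \<Psi> y)"
        using \<Psi> by (subst nn_integral_exp_unit) (auto intro!: ennreal_leI divide_right_mono)
      have "?b \<le> (\<integral>\<^sup>+u. indicator {0..1::real} u \<partial>lborel)"
        using \<Psi> by (intro nn_integral_mono) (auto simp: indicator_def)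
      then have b1: "?b \<le> 1" by simp
      have e: "ennreal (exp (- (r * y powr (1 / s)))) \<le> 1" using r by simp
      consider "y \<le> 1" | "1 < y" "y \<le> l" | "l < y" by linarith
      then show ?thesis
      proof cases
        case 1
        have "ennreal (exp (- (r * y powr (1 / s)))) * ?b \<le> 1 * 1"
          by (intro mult_mono e b1) auto
        then show ?thesis using 1 True by (simp add: add_increasing2 add.assoc)
      next
        case 2
        have "ennreal (exp (- (r * y powr (1 / s)))) * ?b \<le> 1 * ennreal (1 / \<Psi> y)"
          by (intro mult_mono e b) auto
        then show ?thesis using 2 True by (simp add: add_increasing2 add.assoc)
      next
        case 3
        have "?b \<le> ennreal (1 / \<Psi> l)"
          using b mono[of l y] pos[of l] 3 l2
          by (auto intro!: order_trans[OF b] ennreal_leI divide_left_mono mult_pos_pos pos)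
        then have "ennreal (exp (- (r * y powr (1 / s)))) * ?b \<le> ?g y * ennreal (1 / \<Psi> l)"
          by (intro mult_mono) (auto simp: mult.commute)
        then show ?thesis using 3 True l2 by (simp add: mult.commute)
      qed
    qed simp
  qed
  also have "\<dots> = 1 + ?J + ennreal (1 / \<Psi> l) * (ennreal l * stretch_integral s)"
    by (simp add: nn_integral_add nn_integral_cmult inverse_integral_def stretch_integral_scale[OF s r] l_def)
  also have "\<dots> \<le> ennreal (\<Psi> 2) * ?J + ?J + 2 * stretch_integral s * ?J"
  proof (intro add_mono order_refl)
    have "1 = ennreal (\<Psi> 2) * ennreal ((2 - 1) / \<Psi> 2)"
      using pos[of 2] by (simp flip: ennreal_mult')
    also have "\<dots> \<le> ennreal (\<Psi> 2) * ?J"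
      using inverse_integral_ge[of 2] inverse_integral_mono[OF l2] by (intro mult_left_mono) auto
    finally show "1 \<le> ennreal (\<Psi> 2) * ?J" .
    have "ennreal (1 / \<Psi> l) * ennreal l = ennreal (l / \<Psi> l)"
      using l2 pos[of l] by (simp flip: ennreal_mult')
    also have "\<dots> \<le> ennreal (2 * ((l - 1) / \<Psi> l))"
      using l2 pos[of l] by (intro ennreal_leI) (simp add: field_simps)
    also have "\<dots> = 2 * ennreal ((l - 1) / \<Psi> l)"
      using l2 pos[of l] by (subst ennreal_mult) auto
    also have "\<dots> \<le> 2 * ?J"
      using inverse_integral_ge[of l] l2 by (intro mult_left_mono) auto
    finally have "ennreal (1 / \<Psi> l) * ennreal l * stretch_integral s \<le> 2 * ?J * stretch_integral s"
      by (intro mult_right_mono) auto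
    then show "ennreal (1 / \<Psi> l) * (ennreal l * stretch_integral s) \<le> 2 * stretch_integral s * ?J"
      by (simp add: mult_ac)
  qed
  also have "\<dots> = (ennreal (\<Psi> 2) + 1 + 2 * stretch_integral s) * ?J"
    by (simp add: distrib_right)
  finally show ?thesis by (simp add: l_def)
qed

lemma inverse_integral_eq_LBINT:
  assumes "1 \<le> l"
  shows "inverse_integral \<Psi> l = ennreal (LBINT y:{1..l}. 1 / \<Psi> y)"
    and "0 \<le> (LBINT y:{1..l}. 1 / \<Psi> y)"
proof -
  have nonneg: "0 \<le> indicator {1..l} y * (1 / \<Psi> y)" for y
    using pos[of y] by (auto simp: indicator_def)
  have eq: "inverse_integral \<Psi> l = (\<integral>\<^sup>+y. ennreal (indicator {1..l} y * (1 / \<Psi> y)) \<partial>lborel)"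
    unfolding inverse_integral_def
    by (intro nn_integral_cong) (auto simp: indicator_def)
  have "integrable lborel (\<lambda>y. indicator {1..l} y * (1 / \<Psi> y))"
    using inverse_integral_le[OF assms] nonneg
    by (intro integrableI_nonneg) (auto simp: eq intro: le_less_trans)
  then show "inverse_integral \<Psi> l = ennreal (LBINT y:{1..l}. 1 / \<Psi> y)"
    unfolding eq set_lebesgue_integral_def using nonneg
    by (subst nn_integral_eq_integral) auto
  show "0 \<le> (LBINT y:{1..l}. 1 / \<Psi> y)"
    unfolding set_lebesgue_integral_def using nonneg by (intro integral_nonneg_AE) auto
qed

end

section \<open>The index as a growth exponent\<close>

text \<open>
  For the integral of the reciprocal exponent this bound says that the index is at most \<open>1\<close>, so
  that \<open>s * (1 - \<theta>)\<close> is nonnegative.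
\<close>

lemma Liminf_log_ratio_le_1:
  fixes J :: "real \<Rightarrow> real"
  assumes c: "0 < c" and J: "\<And>l. 2 \<le> l \<Longrightarrow> 0 < J l" "\<And>l. 2 \<le> l \<Longrightarrow> J l \<le> c * l"
  shows "Liminf at_top (\<lambda>l::real. ereal (1 / ln l * ln (J l))) \<le> 1"
proof -
  have lim: "((\<lambda>l::real. 1 / ln l * ln (c * l)) \<longlongrightarrow> 1) at_top"
    using c by real_asymp
  have "Liminf at_top (\<lambda>l::real. ereal (1 / ln l * ln (J l)))
      \<le> Liminf at_top (\<lambda>l::real. ereal (1 / ln l * ln (c * l)))"
  proof (rule Liminf_mono)
    show "\<forall>\<^sub>F l in at_top. ereal (1 / ln l * ln (J l)) \<le> ereal (1 / ln l * ln (c * l))"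
      using eventually_ge_at_top[of "2::real"]
    proof eventually_elim
      case (elim l)
      then have "ln (J l) \<le> ln (c * l)" using J[of l] c by (subst ln_le_cancel_iff) auto
      then show ?case using elim by (auto intro!: divide_right_mono)
    qed
  qed
  also have "\<dots> = 1"
    using lim by (intro lim_imp_Liminf) (auto simp: one_ereal_def)
  finally show ?thesis .
qed

text \<open>
  If \<open>t < s * (1 - \<theta>)\<close>, some \<open>q < 1 - t / s\<close> exceeds \<open>\<theta>\<close>, and \<open>J l < l powr q\<close> for arbitrarily
  large \<open>l\<close>. At the radius \<open>r = l powr (- 1 / s)\<close> the bound on \<open>A\<close> then becomes
  \<open>r powr (- t) * A r \<le> C2 * l powr (t / s - 1 + q)\<close>, with a negative exponent.
\<close>

lemma exists_radius_powr_small: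
  fixes J :: "real \<Rightarrow> real" and t s C2 :: real
  defines "\<theta> \<equiv> Liminf at_top (\<lambda>l::real. ereal (1 / ln l * ln (J l)))"
  assumes s: "0 < s" and t: "ereal t < ereal s * (1 - \<theta>)"
    and J: "\<And>l. 2 \<le> l \<Longrightarrow> 0 < J l"
    and C2: "0 < C2" and A: "\<And>r. 0 < r \<Longrightarrow> 2 \<le> r powr (- s) \<Longrightarrow> A r \<le> C2 * (r powr s * J (r powr (- s)))"
    and e: "0 < (e::real)"
  shows "\<exists>r>0. r < e \<and> r powr (- t) * A r \<le> e"
proof -
  have "\<theta> < ereal (1 - t / s)"
    using t s by (cases \<theta>) (auto simp: field_simps one_ereal_def)
  then obtain q where q: "\<theta> < ereal q" "q < 1 - t / s"
    using ereal_dense2[of \<theta> "ereal (1 - t / s)"] by auto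
  have freq: "\<exists>\<^sub>F l in at_top. 1 / ln l * ln (J l) < q"
  proof (rule ccontr)
    assume "\<not> ?thesis"
    then have "\<forall>\<^sub>F l in at_top. ereal q \<le> ereal (1 / ln l * ln (J l))"
      by (simp add: not_frequently not_less)
    then have "ereal q \<le> \<theta>" unfolding \<theta>_def by (rule Liminf_bounded)
    then show False using q by simp
  qed
  have "((\<lambda>l. C2 * l powr (t / s - 1 + q)) \<longlongrightarrow> C2 * 0) at_top"
    using q by (intro tendsto_mult tendsto_const tendsto_neg_powr filterlim_ident) auto
  then have "\<forall>\<^sub>F l in at_top. C2 * l powr (t / s - 1 + q) < e"
    using e by (intro order_tendstoD(2)) auto
  moreover have "((\<lambda>l. l powr (- (1 / s))) \<longlongrightarrow> 0) at_top"
    using s by (intro tendsto_neg_powr filterlim_ident) auto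
  then have "\<forall>\<^sub>F l in at_top. l powr (- (1 / s)) < e"
    using e by (rule order_tendstoD(2))
  ultimately have "\<forall>\<^sub>F l in at_top. C2 * l powr (t / s - 1 + q) < e \<and> l powr (- (1 / s)) < e \<and> 2 \<le> l"
    using eventually_ge_at_top[of "2::real"] by eventually_elim simp
  from frequently_ex[OF frequently_eventually_frequently[OF freq this]]
  obtain l where l: "1 / ln l * ln (J l) < q" "C2 * l powr (t / s - 1 + q) < e"
      "l powr (- (1 / s)) < e" "2 \<le> l"
    by blast
  define r where "r = l powr (- (1 / s))"
  have r: "0 < r" "r powr (- s) = l" "r powr s = l powr (- 1)" "r powr (- t) = l powr (t / s)"
    using l s by (auto simp: r_def powr_powr)
  have "ln (J l) < q * ln l" using l by (simp add: field_simps)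
  then have "J l < l powr q"
    using J[of l] l by (subst ln_less_cancel_iff[symmetric]) (auto simp: ln_powr)
  then have "C2 * (r powr s * J (r powr (- s))) \<le> C2 * (l powr (- 1) * l powr q)"
    unfolding r using C2 by (intro mult_left_mono) auto
  moreover have "A r \<le> C2 * (r powr s * J (r powr (- s)))"
    using A[of r] r l by simp
  ultimately have "r powr (- t) * A r \<le> l powr (t / s) * (C2 * (l powr (- 1) * l powr q))"
    unfolding r(4) by (intro mult_left_mono) auto
  also have "\<dots> = C2 * l powr (t / s - 1 + q)"
    using l by (simp add: powr_add powr_diff powr_minus divide_inverse)
  finally show ?thesis using l r r_def by (intro exI[of _ r]) auto
qed

text \<open>
  If \<open>t > s * (1 - \<theta>)\<close>, some \<open>q > 1 - t / s\<close> is below \<open>\<theta>\<close>, and \<open>J l > l powr q\<close> for all large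
  \<open>l\<close>. Hence the terms are eventually bounded by those of a geometric series with ratio
  \<open>(1/2) powr (t - s * (1 - q))\<close>.
\<close>

lemma summable_powr_inverse:
  fixes J :: "real \<Rightarrow> real" and t s C1 :: real
  defines "\<theta> \<equiv> Liminf at_top (\<lambda>l::real. ereal (1 / ln l * ln (J l)))"
  assumes s: "0 < s" and t: "ereal s * (1 - \<theta>) < ereal t" and "\<theta> \<le> 1"
    and J: "\<And>l. 2 \<le> l \<Longrightarrow> 0 < J l"
    and C1: "0 < C1" and A: "\<And>r. 0 < r \<Longrightarrow> 2 \<le> r powr (- s) \<Longrightarrow> C1 * (r powr s * J (r powr (- s))) \<le> A r"
  shows "summable (\<lambda>n. ((1 / 2) ^ n) powr t / A ((1 / 2) ^ n))"
proof -
  have "ereal (1 - t / s) < \<theta>"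
    using t s \<open>\<theta> \<le> 1\<close> by (cases \<theta>) (auto simp: field_simps one_ereal_def)
  then obtain q where q: "ereal q < \<theta>" "1 - t / s < q"
    using ereal_dense2[of "ereal (1 - t / s)" \<theta>] by auto
  have ev: "\<forall>\<^sub>F l in at_top. q < 1 / ln l * ln (J l) \<and> 2 \<le> l"
    using less_LiminfD[OF q(1)[unfolded \<theta>_def]] eventually_ge_at_top[of "2::real"]
    by eventually_elim simp
  have lim: "filterlim (\<lambda>n. ((1 / 2 :: real) ^ n) powr (- s)) at_top sequentially"
    using s by real_asymp
  define p where "p = t - s * (1 - q)"
  have p: "0 < p" using q s by (simp add: p_def field_simps)
  show ?thesis
  proof (rule summable_comparison_test_ev)
    have "norm ((1 / 2 :: real) powr p) < 1"
      using p by (simp add: powr01_less_one)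
    then show "summable (\<lambda>n. 1 / C1 * ((1 / 2) powr p) ^ n)"
      by (intro summable_mult summable_geometric)
    show "\<forall>\<^sub>F n in sequentially. norm (((1 / 2) ^ n) powr t / A ((1 / 2) ^ n)) \<le> 1 / C1 * ((1 / 2) powr p) ^ n"
      using eventually_compose_filterlim[OF ev lim]
    proof eventually_elim
      case (elim n)
      define r where "r = (1 / 2 :: real) ^ n"
      define l where "l = r powr (- s)"
      have r: "0 < r" by (simp add: r_def)
      have l: "q < 1 / ln l * ln (J l)" "2 \<le> l" using elim by (auto simp: l_def r_def)
      have "q * ln l < ln (J l)" using l by (simp add: field_simps)
      then have "l powr q < J l"
        using J[of l] l by (subst ln_less_cancel_iff[symmetric]) (auto simp: ln_powr)
      then have "C1 * (r powr s * l powr q) \<le> C1 * (r powr s * J l)"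
        using C1 by (intro mult_left_mono) auto
      also have "\<dots> \<le> A r" using A[of r] l r by (simp add: l_def)
      finally have A': "C1 * (r powr s * l powr q) \<le> A r" .
      have pos: "0 < C1 * (r powr s * l powr q)" using C1 r l by simp
      have "norm (r powr t / A r) = r powr t / A r" using A' pos by simp
      also have "\<dots> \<le> r powr t / (C1 * (r powr s * l powr q))"
        using A' pos by (intro divide_left_mono) auto
      also have "l powr q = r powr (- s * q)" by (simp add: l_def powr_powr)
      also have "r powr t / (C1 * (r powr s * r powr (- s * q))) = 1 / C1 * r powr p"
      proof -
        have "r powr t = r powr p * (r powr s * r powr (- s * q))"
          by (simp add: p_def algebra_simps flip: powr_add)
        then show ?thesis using r C1 by simp
      qed
      also have "r powr p = ((1 / 2) powr p) ^ n"
        by (simp add: r_def powr_powr mult.commute flip: powr_realpow)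
      finally show ?case by (simp add: r_def)
    qed
  qed
qed

section \<open>Subordinators with regular paths\<close>

text \<open>
  Path properties are required at every point of the space, which makes the process jointly
  measurable in time and chance.
\<close>

locale regular_subordinator = subordinator M S for M :: "'a measure" and S :: "real \<Rightarrow> 'a \<Rightarrow> real" +
  assumes start: "\<omega> \<in> space M \<Longrightarrow> S 0 \<omega> = 0"
    and monotone_path: "\<omega> \<in> space M \<Longrightarrow> 0 \<le> t \<Longrightarrow> t \<le> u \<Longrightarrow> S t \<omega> \<le> S u \<omega>"
    and right_continuous: "\<omega> \<in> space M \<Longrightarrow> 0 \<le> t \<Longrightarrow> continuous (at_right t) (\<lambda>u. S u \<omega>)"

text \<open>
  Set the process to zero on a null set outside of which all path properties hold. Laws of
  increments and their independence only depend on the process up to null sets.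
\<close>

lemma (in subordinator) regular_version:
  "\<exists>X. regular_subordinator M X \<and> (AE \<omega> in M. \<forall>t. X t \<omega> = S t \<omega>)"
proof -
  have "AE \<omega> in M. S 0 \<omega> = 0 \<and> mono_on {0..} (\<lambda>t. S t \<omega>)
      \<and> ((\<forall>t\<ge>0. continuous (at_right t) (\<lambda>u. S u \<omega>)) \<and> (\<forall>t>0. \<exists>l. ((\<lambda>u. S u \<omega>) \<longlongrightarrow> l) (at_left t)))"
    using starts_at_0 nondecreasing_paths cadlag_paths by eventually_elim simp
  then obtain N where bad: "{\<omega> \<in> space M. \<not> (S 0 \<omega> = 0 \<and> mono_on {0..} (\<lambda>t. S t \<omega>)
      \<and> ((\<forall>t\<ge>0. continuous (at_right t) (\<lambda>u. S u \<omega>)) \<and> (\<forall>t>0. \<exists>l. ((\<lambda>u. S u \<omega>) \<longlongrightarrow> l) (at_left t))))} \<subseteq> N"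
    and N: "emeasure M N = 0" "N \<in> sets M"
    by (elim AE_E)
  have good: "S 0 \<omega> = 0" "mono_on {0..} (\<lambda>t. S t \<omega>)"
    "\<forall>t\<ge>0. continuous (at_right t) (\<lambda>u. S u \<omega>)" "\<forall>t>0. \<exists>l. ((\<lambda>u. S u \<omega>) \<longlongrightarrow> l) (at_left t)"
    if "\<omega> \<in> space M" "\<omega> \<notin> N" for \<omega>
    using bad that by blast+
  define X where "X t \<omega> = (if \<omega> \<in> N then 0 else S t \<omega>)" for t \<omega>
  have AE_N: "AE \<omega> in M. \<omega> \<notin> N"
    using N by (auto simp: null_sets_def intro!: AE_not_in)
  have meas: "X t \<in> borel_measurable M" if "0 \<le> t" for t
    unfolding X_def using N measurable_process[OF that] by measurable
  note [measurable] = meas measurable_process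
  have distr: "distr M borel (\<lambda>\<omega>. X t \<omega> - X u \<omega>) = distr M borel (\<lambda>\<omega>. S t \<omega> - S u \<omega>)"
    if "0 \<le> t" "0 \<le> u" for t u
  proof (rule distr_cong_AE)
    show "AE \<omega> in M. X t \<omega> - X u \<omega> = S t \<omega> - S u \<omega>"
      using AE_N by (auto simp: X_def elim: eventually_mono)
  qed (use that in auto)
  have indep: "indep_vars (\<lambda>_. borel) (\<lambda>i \<omega>. X (\<tau> (Suc i)) \<omega> - X (\<tau> i) \<omega>) {..<n}"
    if \<tau>: "0 \<le> \<tau> 0" "\<And>i. i < n \<Longrightarrow> \<tau> i \<le> \<tau> (Suc i)" for n :: nat and \<tau>
  proof (cases "n = 0")
    case True
    then show ?thesis by (auto simp: indep_vars_def indep_sets_def)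
  next
    case False
    have nonneg: "0 \<le> \<tau> i" if "i \<le> n" for i
      using that by (induction i) (use \<tau> in \<open>auto intro: order_trans\<close>)
    have "distr M (\<Pi>\<^sub>M i\<in>{..<n}. borel) (\<lambda>\<omega>. \<lambda>i\<in>{..<n}. X (\<tau> (Suc i)) \<omega> - X (\<tau> i) \<omega>)
        = distr M (\<Pi>\<^sub>M i\<in>{..<n}. borel) (\<lambda>\<omega>. \<lambda>i\<in>{..<n}. S (\<tau> (Suc i)) \<omega> - S (\<tau> i) \<omega>)"
    proof (rule distr_cong_AE)
      show "AE \<omega> in M. (\<lambda>i\<in>{..<n}. X (\<tau> (Suc i)) \<omega> - X (\<tau> i) \<omega>) = (\<lambda>i\<in>{..<n}. S (\<tau> (Suc i)) \<omega> - S (\<tau> i) \<omega>)"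
        using AE_N by (auto simp: X_def elim: eventually_mono)
    qed (use nonneg in \<open>auto simp: Suc_le_eq\<close>)
    also have "\<dots> = (\<Pi>\<^sub>M i\<in>{..<n}. distr M borel (\<lambda>\<omega>. S (\<tau> (Suc i)) \<omega> - S (\<tau> i) \<omega>))"
      using independent_increments[OF \<tau>] False nonneg
      by (intro indep_vars_iff_distr_eq_PiM'[THEN iffD1]) (auto simp: Suc_le_eq)
    also have "\<dots> = (\<Pi>\<^sub>M i\<in>{..<n}. distr M borel (\<lambda>\<omega>. X (\<tau> (Suc i)) \<omega> - X (\<tau> i) \<omega>))"
      using nonneg by (intro PiM_cong) (auto simp: distr)
    finally show ?thesis
      using False nonneg
      by (intro indep_vars_iff_distr_eq_PiM'[THEN iffD2]) (auto simp: Suc_le_eq)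
  qed
  have "regular_subordinator M X"
  proof unfold_locales
    show "X t \<in> borel_measurable M" if "0 \<le> t" for t using meas that .
    show "distr M borel (\<lambda>\<omega>. X (t + h) \<omega> - X t \<omega>) = distr M borel (\<lambda>\<omega>. X h \<omega> - X 0 \<omega>)"
      if "0 \<le> t" "0 \<le> h" for t h
      using that stationary_increments[of t h] by (simp add: distr)
    show "indep_vars (\<lambda>_. borel) (\<lambda>i \<omega>. X (\<tau> (Suc i)) \<omega> - X (\<tau> i) \<omega>) {..<n}"
      if "0 \<le> \<tau> 0" "\<And>i. i < n \<Longrightarrow> \<tau> i \<le> \<tau> (Suc i)" for n :: nat and \<tau>
      using indep that .
    show start: "X 0 \<omega> = 0" if "\<omega> \<in> space M" for \<omega>
      using good that by (auto simp: X_def)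
    show mono: "X t \<omega> \<le> X u \<omega>" if "\<omega> \<in> space M" "0 \<le> t" "t \<le> u" for \<omega> t u
      using good(2) that by (auto simp: X_def mono_on_def)
    show cont: "continuous (at_right t) (\<lambda>u. X u \<omega>)" if "\<omega> \<in> space M" "0 \<le> t" for \<omega> t
      using good(3) that by (cases "\<omega> \<in> N") (auto simp: X_def)
    have left: "\<exists>l. ((\<lambda>u. X u \<omega>) \<longlongrightarrow> l) (at_left t)" if "\<omega> \<in> space M" "0 < t" for \<omega> t
      using good(4) that by (cases "\<omega> \<in> N") (auto simp: X_def)
    show "AE \<omega> in M. X 0 \<omega> = 0" using start by simp
    show "AE \<omega> in M. (\<forall>t\<ge>0. continuous (at_right t) (\<lambda>u. X u \<omega>)) \<and>
        (\<forall>t>0. \<exists>l. ((\<lambda>u. X u \<omega>) \<longlongrightarrow> l) (at_left t))"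
      using cont left by simp
    show "AE \<omega> in M. mono_on {0..} (\<lambda>t. X t \<omega>)"
      using mono by (simp add: mono_on_def)
  qed
  moreover have "AE \<omega> in M. \<forall>t. X t \<omega> = S t \<omega>"
    using AE_N by (auto simp: X_def elim: eventually_mono)
  ultimately show ?thesis by blast
qed

context regular_subordinator
begin

lemma path_nonneg: "\<omega> \<in> space M \<Longrightarrow> 0 \<le> t \<Longrightarrow> 0 \<le> S t \<omega>"
  using start monotone_path[of \<omega> 0 t] by simp

lemma right_continuousE:
  assumes "\<omega> \<in> space M" "0 \<le> t" "0 < e"
  obtains d where "0 < d" "\<And>u. t \<le> u \<Longrightarrow> u < t + d \<Longrightarrow> \<bar>S u \<omega> - S t \<omega>\<bar> < e"
proof -
  have "((\<lambda>u. S u \<omega>) \<longlongrightarrow> S t \<omega>) (at_right t)"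
    using right_continuous[OF assms(1,2)] by (simp add: continuous_within)
  then have "\<forall>\<^sub>F u in at_right t. dist (S u \<omega>) (S t \<omega>) < e"
    using assms(3) by (rule tendstoD)
  then obtain b where b: "t < b" "\<And>u. t < u \<Longrightarrow> u < b \<Longrightarrow> dist (S u \<omega>) (S t \<omega>) < e"
    by (auto simp: eventually_at_right[OF less_add_one[of t]])
  show ?thesis
  proof (rule that[of "b - t"])
    show "\<bar>S u \<omega> - S t \<omega>\<bar> < e" if "t \<le> u" "u < t + (b - t)" for u
      using b(2)[of u] that assms(3) by (cases "u = t") (auto simp: dist_real_def)
  qed (use b in simp)
qed

text \<open>
  By right-continuity the process is the limit of its values at the times \<open>t\<close> rounded up to
  multiples of \<open>1 / (n + 1)\<close>. Times are clipped at \<open>0\<close> because the process is unrestricted at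
  negative times.
\<close>

lemma jointly_measurable:
  "(\<lambda>(t, \<omega>). S (max 0 t) \<omega>) \<in> borel_measurable (borel \<Otimes>\<^sub>M M)"
proof -
  define q where "q n t = nat \<lceil>real (Suc n) * max 0 t\<rceil>" for n t
  have [measurable]: "(\<lambda>x. q n (fst x)) \<in> measurable (borel \<Otimes>\<^sub>M M) (count_space UNIV)" for n
    unfolding q_def by measurable
  have approx: "(\<lambda>x. S (real (q n (fst x)) / real (Suc n)) (snd x)) \<in> borel_measurable (borel \<Otimes>\<^sub>M M)" for n
  proof (rule measurable_compose_countable[where f = "\<lambda>i x. S (real i / real (Suc n)) (snd x)"])
    show "(\<lambda>x. S (real i / real (Suc n)) (snd x)) \<in> borel_measurable (borel \<Otimes>\<^sub>M M)" for i
      using measurable_process[of "real i / real (Suc n)"] by measurable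
  qed measurable
  have "(\<lambda>x. S (max 0 (fst x)) (snd x)) \<in> borel_measurable (borel \<Otimes>\<^sub>M M)"
  proof (rule borel_measurable_LIMSEQ_real[OF _ approx])
    fix x :: "real \<times> 'a" assume "x \<in> space (borel \<Otimes>\<^sub>M M)"
    then have \<omega>: "snd x \<in> space M" by (auto simp: space_pair_measure)
    define t where "t = max 0 (fst x)"
    have t: "0 \<le> t" by (simp add: t_def)
    have q: "t \<le> real (q n (fst x)) / real (Suc n)" "real (q n (fst x)) / real (Suc n) < t + 1 / real (Suc n)" for n
    proof -
      have "real (q n (fst x)) = of_int \<lceil>real (Suc n) * t\<rceil>"
        unfolding q_def t_def[symmetric] using t by (simp add: zero_le_mult_iff)
      moreover have "real (Suc n) * t \<le> of_int \<lceil>real (Suc n) * t\<rceil>" by (rule le_of_int_ceiling)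
      moreover have "of_int \<lceil>real (Suc n) * t\<rceil> < real (Suc n) * t + 1" by linarith
      moreover have "(t + 1 / real (Suc n)) * real (Suc n) = real (Suc n) * t + 1"
        by (simp add: distrib_right del: of_nat_Suc)
      ultimately show "t \<le> real (q n (fst x)) / real (Suc n)" "real (q n (fst x)) / real (Suc n) < t + 1 / real (Suc n)"
        by (simp_all add: pos_le_divide_eq pos_divide_less_eq mult.commute del: of_nat_Suc)
    qed
    show "(\<lambda>n. S (real (q n (fst x)) / real (Suc n)) (snd x)) \<longlonglongrightarrow> S (max 0 (fst x)) (snd x)"
    proof (rule LIMSEQ_I)
      fix e :: real assume "0 < e"
      from right_continuousE[OF \<omega> t this]
      obtain d where d: "0 < d" "\<And>u. t \<le> u \<Longrightarrow> u < t + d \<Longrightarrow> \<bar>S u (snd x) - S t (snd x)\<bar> < e"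
        by blast
      obtain n0 where n0: "1 / real (Suc n0) < d" using d(1) nat_approx_posE by blast
      have "norm (S (real (q n (fst x)) / real (Suc n)) (snd x) - S t (snd x)) < e" if "n0 \<le> n" for n
      proof -
        have "1 / real (Suc n) \<le> 1 / real (Suc n0)" using that by (simp add: field_simps)
        then show ?thesis using q[of n] n0 d(2) by simp
      qed
      then show "\<exists>n0. \<forall>n\<ge>n0. norm (S (real (q n (fst x)) / real (Suc n)) (snd x) - S (max 0 (fst x)) (snd x)) < e"
        unfolding t_def by blast
    qed
  qed
  then show ?thesis by (simp add: case_prod_beta')
qed

lemma jointly_measurable' [measurable (raw)]:
  assumes [measurable]: "f \<in> borel_measurable N" "g \<in> measurable N M"
  shows "(\<lambda>x. S (max 0 (f x)) (g x)) \<in> borel_measurable N"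
  using measurable_compose[OF measurable_Pair[OF assms] jointly_measurable] by simp

lemma nn_integral_increment:
  assumes [measurable]: "f \<in> borel_measurable borel" and "0 \<le> t" "t \<le> u"
  shows "(\<integral>\<^sup>+\<omega>. f (S u \<omega> - S t \<omega>) \<partial>M) = (\<integral>\<^sup>+\<omega>. f (S (u - t) \<omega>) \<partial>M)"
proof -
  note [measurable] = measurable_process
  have "distr M borel (\<lambda>\<omega>. S u \<omega> - S t \<omega>) = distr M borel (\<lambda>\<omega>. S (u - t) \<omega> - S 0 \<omega>)"
    using stationary_increments[of t "u - t"] assms by simp
  also have "\<dots> = distr M borel (S (u - t))"
    by (intro distr_cong) (auto simp: start)
  finally have "(\<integral>\<^sup>+x. f x \<partial>distr M borel (\<lambda>\<omega>. S u \<omega> - S t \<omega>)) = (\<integral>\<^sup>+x. f x \<partial>distr M borel (S (u - t)))"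
    by simp
  then show ?thesis
    using assms by (simp add: nn_integral_distr)
qed

section \<open>The mean potential at a given scale\<close>

definition mean_potential :: "real \<Rightarrow> real \<Rightarrow> ennreal" where
  "mean_potential s r = (\<integral>\<^sup>+u. indicator {0..1} u
     * (\<integral>\<^sup>+\<omega>. ennreal (smooth_kernel s r (S (max 0 u) \<omega>)) \<partial>M) \<partial>lborel)"

lemma mean_potential_le_1:
  assumes "0 < s" "0 < r"
  shows "mean_potential s r \<le> 1"
proof -
  have "mean_potential s r \<le> (\<integral>\<^sup>+u. indicator {0..1::real} u \<partial>lborel)"
    unfolding mean_potential_def
  proof (intro nn_integral_mono)
    fix u :: real
    have "(\<integral>\<^sup>+\<omega>. ennreal (smooth_kernel s r (S (max 0 u) \<omega>)) \<partial>M) \<le> (\<integral>\<^sup>+\<omega>. 1 \<partial>M)"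
      using assms by (intro nn_integral_mono) (auto intro!: smooth_kernel_le_1 path_nonneg)
    then show "indicator {0..1} u * (\<integral>\<^sup>+\<omega>. ennreal (smooth_kernel s r (S (max 0 u) \<omega>)) \<partial>M) \<le> indicator {0..1} u"
      by (auto simp: emeasure_space_1 indicator_def)
  qed
  then show ?thesis by simp
qed

text \<open>
  The kernel is positive everywhere, so it has positive expectation at time \<open>1\<close>; at earlier
  times the expectation is larger.
\<close>

lemma mean_potential_pos:
  assumes s: "0 < s" and r: "0 < r"
  shows "0 < mean_potential s r"
proof -
  let ?g = "\<lambda>u. \<integral>\<^sup>+\<omega>. ennreal (smooth_kernel s r (S u \<omega>)) \<partial>M"
  note [measurable] = measurable_process[of 1]
  have "?g 1 = (\<integral>\<^sup>+u. ?g 1 * indicator {0..1::real} u \<partial>lborel)"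
    by (simp add: nn_integral_cmult)
  also have "\<dots> \<le> mean_potential s r"
    unfolding mean_potential_def
  proof (intro nn_integral_mono)
    fix u :: real
    show "?g 1 * indicator {0..1} u \<le> indicator {0..1} u * ?g (max 0 u)"
    proof (cases "u \<in> {0..1}")
      case True
      then have "?g 1 \<le> ?g (max 0 u)"
        by (intro nn_integral_mono ennreal_leI smooth_kernel_antimono s r)
           (auto intro!: path_nonneg monotone_path)
      then show ?thesis using True by simp
    qed simp
  qed
  finally have le: "?g 1 \<le> mean_potential s r" .
  have "?g 1 \<noteq> 0"
  proof
    assume "?g 1 = 0"
    then have "AE \<omega> in M. smooth_kernel s r (S 1 \<omega>) \<le> 0"
      by (subst (asm) nn_integral_0_iff_AE) (auto simp: ennreal_eq_0_iff)
    moreover have "AE \<omega> in M. 0 < smooth_kernel s r (S 1 \<omega>)"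
    proof (rule AE_I2)
      fix \<omega> assume "\<omega> \<in> space M"
      then have "0 \<le> S 1 \<omega> / r" using path_nonneg[of \<omega> 1] r by simp
      then show "0 < smooth_kernel s r (S 1 \<omega>)" by (simp add: smooth_kernel_def add_nonneg_eq_0_iff)
    qed
    ultimately have "AE \<omega> in M. False" by eventually_elim simp
    then show False by simp
  qed
  then show ?thesis using le by (auto simp: zero_less_iff_neq_zero)
qed

lemma ennreal_mean_potential:
  assumes "0 < s" "0 < r"
  shows "mean_potential s r = ennreal (enn2real (mean_potential s r))"
  using mean_potential_le_1[OF assms] by (auto simp: ennreal_enn2real_if top_unique)

end

locale nonzero_subordinator = regular_subordinator M S for M :: "'a measure" and S +
  fixes \<Phi> :: "real \<Rightarrow> real"
  assumes laplace: "laplace_exponent M S \<Phi>"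
    and nonzero: "\<exists>t\<ge>0. \<not> (AE \<omega> in M. S t \<omega> = 0)"
begin

lemma nn_integral_exp:
  assumes "0 \<le> t" "0 < l"
  shows "(\<integral>\<^sup>+\<omega>. ennreal (exp (- (l * S t \<omega>))) \<partial>M) = ennreal (exp (- (t * \<Phi> l)))"
proof (cases "t = 0")
  case True
  then have "(\<integral>\<^sup>+\<omega>. ennreal (exp (- (l * S t \<omega>))) \<partial>M) = (\<integral>\<^sup>+\<omega>. 1 \<partial>M)"
    by (intro nn_integral_cong) (simp add: start)
  then show ?thesis using True by (simp add: emeasure_space_1)
next
  case False
  note [measurable] = measurable_process[OF assms(1)]
  have "integrable M (\<lambda>\<omega>. exp (- (l * S t \<omega>)))"
    by (rule integrable_const_bound[where B = 1]) (use assms in \<open>auto intro!: AE_I2 mult_nonneg_nonneg path_nonneg\<close>)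
  then have "(\<integral>\<^sup>+\<omega>. ennreal (exp (- (l * S t \<omega>))) \<partial>M) = ennreal (\<integral>\<omega>. exp (- (l * S t \<omega>)) \<partial>M)"
    by (intro nn_integral_eq_integral) auto
  then show ?thesis
    using laplace assms False by (simp add: laplace_exponent_def)
qed

lemma exponent_mono:
  assumes "0 < l" "l \<le> l'"
  shows "\<Phi> l \<le> \<Phi> l'"
proof -
  have "(\<integral>\<^sup>+\<omega>. ennreal (exp (- (l' * S 1 \<omega>))) \<partial>M) \<le> (\<integral>\<^sup>+\<omega>. ennreal (exp (- (l * S 1 \<omega>))) \<partial>M)"
    using assms by (intro nn_integral_mono ennreal_leI) (auto intro!: mult_right_mono path_nonneg)
  then show ?thesis
    using assms by (simp add: nn_integral_exp)
qed

text \<open>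
  If \<open>\<Phi> l \<le> 0\<close>, then \<open>exp (- l * S t)\<close>, which is at most \<open>1\<close>, has expectation at least \<open>1\<close>, so
  that \<open>S t = 0\<close> almost surely, for every \<open>t\<close>.
\<close>

lemma exponent_pos:
  assumes "0 < l"
  shows "0 < \<Phi> l"
proof (rule ccontr)
  assume "\<not> 0 < \<Phi> l"
  have "AE \<omega> in M. S t \<omega> = 0" if t: "0 \<le> t" for t
  proof -
    note [measurable] = measurable_process[OF t]
    have int: "integrable M (\<lambda>\<omega>. exp (- (l * S t \<omega>)))"
      by (rule integrable_const_bound[where B = 1]) (use assms t in \<open>auto intro!: AE_I2 mult_nonneg_nonneg path_nonneg\<close>)
    have nonneg: "0 \<le> 1 - exp (- (l * S t \<omega>))" if "\<omega> \<in> space M" for \<omega>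
      using that assms t by (auto intro!: mult_nonneg_nonneg path_nonneg)
    have "(\<integral>\<omega>. exp (- (l * S t \<omega>)) \<partial>M) = exp (- (t * \<Phi> l))"
      using nn_integral_exp[OF t assms] int by (simp add: nn_integral_eq_integral)
    also have "\<dots> \<ge> 1" using t \<open>\<not> 0 < \<Phi> l\<close> by (simp add: mult_le_0_iff)
    finally have "(\<integral>\<omega>. 1 - exp (- (l * S t \<omega>)) \<partial>M) \<le> 0"
      using int by (simp add: prob_space)
    moreover have "0 \<le> (\<integral>\<omega>. 1 - exp (- (l * S t \<omega>)) \<partial>M)"
      using nonneg by (intro integral_nonneg_AE) auto
    ultimately have "(\<integral>\<omega>. 1 - exp (- (l * S t \<omega>)) \<partial>M) = 0" by simp
    then have "AE \<omega> in M. 1 - exp (- (l * S t \<omega>)) = 0"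
      using int nonneg by (subst (asm) integral_nonneg_eq_0_iff_AE) auto
    then show ?thesis using assms by (auto elim: eventually_mono)
  qed
  then show False using nonzero by blast
qed

text \<open>
  The Laplace exponent is arbitrary at nonpositive arguments; the value \<open>0\<close> there makes the
  function increasing on the whole line, hence measurable.
\<close>

definition rescaled_exponent :: "real \<Rightarrow> real \<Rightarrow> real" where
  "rescaled_exponent s y = (if y \<le> 0 then 0 else \<Phi> (y powr (1 / s)))"

lemma rescaled_exponent_pos: "0 < y \<Longrightarrow> 0 < rescaled_exponent s y"
  by (simp add: rescaled_exponent_def exponent_pos)

lemma rescaled_exponent_mono:
  assumes "0 < s" "y \<le> y'"
  shows "rescaled_exponent s y \<le> rescaled_exponent s y'"
  using assms
  by (auto simp: rescaled_exponent_def intro!: exponent_mono powr_mono2 less_imp_le[OF exponent_pos])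

lemma rescaled_exponent_measurable:
  "0 < s \<Longrightarrow> rescaled_exponent s \<in> borel_measurable borel"
  by (intro borel_measurable_mono monoI rescaled_exponent_mono)

text \<open>
  Write the kernel as a mixture of exponentials and apply Tonelli's theorem twice.
\<close>

lemma mean_potential_eq:
  assumes s: "0 < s" and r: "0 < r"
  shows "stretch_integral s * mean_potential s r = ennreal (r powr s) * smoothed_sojourn s (rescaled_exponent s) r"
proof -
  note [measurable] = rescaled_exponent_measurable[OF s]
  interpret P: pair_sigma_finite lborel M
    by (intro pair_sigma_finite.intro sigma_finite_lborel sigma_finite_measure_axioms)
  have one: "stretch_integral s * (\<integral>\<^sup>+\<omega>. ennreal (smooth_kernel s r (S (max 0 u) \<omega>)) \<partial>M)
      = ennreal (r powr s) * (\<integral>\<^sup>+x. indicator {0<..} x * (ennreal (exp (- (r * x powr (1 / s))))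
          * ennreal (exp (- (u * rescaled_exponent s x)))) \<partial>lborel)"
    if u: "0 \<le> u" for u
  proof -
    note [measurable] = measurable_process[OF u]
    have "stretch_integral s * (\<integral>\<^sup>+\<omega>. ennreal (smooth_kernel s r (S (max 0 u) \<omega>)) \<partial>M)
        = (\<integral>\<^sup>+\<omega>. stretch_integral s * ennreal (smooth_kernel s r (S u \<omega>)) \<partial>M)"
      using u by (simp add: nn_integral_cmult)
    also have "\<dots> = (\<integral>\<^sup>+\<omega>. ennreal (r powr s) * (\<integral>\<^sup>+x. indicator {0<..} x
          * ennreal (exp (- (x powr (1 / s) * (r + S u \<omega>)))) \<partial>lborel) \<partial>M)"
      using u by (intro nn_integral_cong smooth_kernel_stretch s r path_nonneg)
    also have "\<dots> = ennreal (r powr s) * (\<integral>\<^sup>+\<omega>. (\<integral>\<^sup>+x. indicator {0<..} x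
          * ennreal (exp (- (x powr (1 / s) * (r + S u \<omega>)))) \<partial>lborel) \<partial>M)"
      by (intro nn_integral_cmult) measurable
    also have "(\<integral>\<^sup>+\<omega>. (\<integral>\<^sup>+x. indicator {0<..} x * ennreal (exp (- (x powr (1 / s) * (r + S u \<omega>)))) \<partial>lborel) \<partial>M)
        = (\<integral>\<^sup>+x. (\<integral>\<^sup>+\<omega>. indicator {0<..} x * ennreal (exp (- (x powr (1 / s) * (r + S u \<omega>)))) \<partial>M) \<partial>lborel)"
      by (rule P.Fubini') measurable
    also have "\<dots> = (\<integral>\<^sup>+x. indicator {0<..} x * (ennreal (exp (- (r * x powr (1 / s))))
          * ennreal (exp (- (u * rescaled_exponent s x)))) \<partial>lborel)"
    proof (intro nn_integral_cong)
      fix x :: real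
      show "(\<integral>\<^sup>+\<omega>. indicator {0<..} x * ennreal (exp (- (x powr (1 / s) * (r + S u \<omega>)))) \<partial>M)
        = indicator {0<..} x * (ennreal (exp (- (r * x powr (1 / s)))) * ennreal (exp (- (u * rescaled_exponent s x))))"
      proof (cases "0 < x")
        case True
        have "(\<integral>\<^sup>+\<omega>. ennreal (exp (- (x powr (1 / s) * (r + S u \<omega>)))) \<partial>M)
            = (\<integral>\<^sup>+\<omega>. ennreal (exp (- (r * x powr (1 / s)))) * ennreal (exp (- (x powr (1 / s) * S u \<omega>))) \<partial>M)"
          by (intro nn_integral_cong) (simp add: algebra_simps flip: ennreal_mult' exp_add)
        also have "\<dots> = ennreal (exp (- (r * x powr (1 / s)))) * ennreal (exp (- (u * \<Phi> (x powr (1 / s)))))"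
          using True u by (subst nn_integral_cmult) (auto simp: nn_integral_exp)
        finally show ?thesis using True by (simp add: rescaled_exponent_def)
      qed simp
    qed
    finally show ?thesis .
  qed
  have "stretch_integral s * mean_potential s r
      = (\<integral>\<^sup>+u. stretch_integral s * (indicator {0..1} u
          * (\<integral>\<^sup>+\<omega>. ennreal (smooth_kernel s r (S (max 0 u) \<omega>)) \<partial>M)) \<partial>lborel)"
    unfolding mean_potential_def by (intro nn_integral_cmult[symmetric]) measurable
  also have "\<dots> = (\<integral>\<^sup>+u. ennreal (r powr s) * (\<integral>\<^sup>+x. indicator {0<..} x * (ennreal (exp (- (r * x powr (1 / s))))
          * (indicator {0..1} u * ennreal (exp (- (u * rescaled_exponent s x))))) \<partial>lborel) \<partial>lborel)"
  proof (intro nn_integral_cong)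
    fix u :: real
    show "stretch_integral s * (indicator {0..1} u
          * (\<integral>\<^sup>+\<omega>. ennreal (smooth_kernel s r (S (max 0 u) \<omega>)) \<partial>M))
      = ennreal (r powr s) * (\<integral>\<^sup>+x. indicator {0<..} x * (ennreal (exp (- (r * x powr (1 / s))))
          * (indicator {0..1} u * ennreal (exp (- (u * rescaled_exponent s x))))) \<partial>lborel)"
      using one[of u] by (cases "u \<in> {0..1}") auto
  qed
  also have "\<dots> = ennreal (r powr s) * (\<integral>\<^sup>+u. (\<integral>\<^sup>+x. indicator {0<..} x * (ennreal (exp (- (r * x powr (1 / s))))
          * (indicator {0..1} u * ennreal (exp (- (u * rescaled_exponent s x))))) \<partial>lborel) \<partial>lborel)"
    by (intro nn_integral_cmult) measurable
  also have "(\<integral>\<^sup>+u. (\<integral>\<^sup>+x. indicator {0<..} x * (ennreal (exp (- (r * x powr (1 / s))))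
          * (indicator {0..1} u * ennreal (exp (- (u * rescaled_exponent s x))))) \<partial>lborel) \<partial>lborel)
      = (\<integral>\<^sup>+x. (\<integral>\<^sup>+u. indicator {0<..} x * (ennreal (exp (- (r * x powr (1 / s))))
          * (indicator {0..1} u * ennreal (exp (- (u * rescaled_exponent s x))))) \<partial>lborel) \<partial>lborel)"
    by (rule lborel_pair.Fubini') measurable
  also have "\<dots> = smoothed_sojourn s (rescaled_exponent s) r"
    unfolding smoothed_sojourn_def
    by (intro nn_integral_cong) (simp add: nn_integral_cmult)
  finally show ?thesis .
qed

definition reciprocal_integral :: "real \<Rightarrow> real \<Rightarrow> real" where
  "reciprocal_integral s l = (LBINT x:{1..l}. 1 / \<Phi> (x powr (1 / s)))"

lemma reciprocal_integral_bounds: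
  assumes s: "0 < s" and l: "1 \<le> l"
  shows "inverse_integral (rescaled_exponent s) l = ennreal (reciprocal_integral s l)"
    and "0 \<le> reciprocal_integral s l"
    and "reciprocal_integral s l \<le> 1 / \<Phi> 1 * l"
    and "2 \<le> l \<Longrightarrow> 0 < reciprocal_integral s l"
proof -
  note \<Psi> = rescaled_exponent_measurable[OF s] rescaled_exponent_pos[of _ s] rescaled_exponent_mono[OF s]
  have eq: "reciprocal_integral s l = (LBINT y:{1..l}. 1 / rescaled_exponent s y)"
    unfolding reciprocal_integral_def
    by (rule set_lebesgue_integral_cong) (auto simp: rescaled_exponent_def)
  show 1: "inverse_integral (rescaled_exponent s) l = ennreal (reciprocal_integral s l)"
    and 2: "0 \<le> reciprocal_integral s l"
    unfolding eq using inverse_integral_eq_LBINT[of "rescaled_exponent s" l] \<Psi> l by auto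
  have "inverse_integral (rescaled_exponent s) l \<le> ennreal (l / rescaled_exponent s 1)"
    using inverse_integral_le[of "rescaled_exponent s" l] \<Psi> l by auto
  then show "reciprocal_integral s l \<le> 1 / \<Phi> 1 * l"
    using exponent_pos[of 1] l by (simp add: 1 rescaled_exponent_def)
  assume l2: "2 \<le> l"
  have "ennreal ((l - 1) / rescaled_exponent s l) \<le> inverse_integral (rescaled_exponent s) l"
    using inverse_integral_ge[of "rescaled_exponent s" l] \<Psi> l by auto
  then have "(l - 1) / rescaled_exponent s l \<le> reciprocal_integral s l"
    using 2 by (simp add: 1)
  moreover have "0 < (l - 1) / rescaled_exponent s l"
    using l2 rescaled_exponent_pos[of l s] by simp
  ultimately show "0 < reciprocal_integral s l" by linarith
qed

lemma mean_potential_bounds: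
  assumes s: "0 < s"
  obtains C1 C2 where "0 < C1" "0 < C2"
    "\<And>r. 0 < r \<Longrightarrow> 2 \<le> r powr (- s) \<Longrightarrow>
      C1 * (r powr s * reciprocal_integral s (r powr (- s))) \<le> enn2real (mean_potential s r)"
    "\<And>r. 0 < r \<Longrightarrow> 2 \<le> r powr (- s) \<Longrightarrow>
      enn2real (mean_potential s r) \<le> C2 * (r powr s * reciprocal_integral s (r powr (- s)))"
proof -
  let ?\<Psi> = "rescaled_exponent s"
  note \<Psi> = rescaled_exponent_measurable[OF s] rescaled_exponent_pos[of _ s] rescaled_exponent_mono[OF s]
  define c where "c = enn2real (stretch_integral s)"
  have c: "stretch_integral s = ennreal c" "0 < c"
    using stretch_integral_finite[OF s] stretch_integral_pos[OF s]
    by (auto simp: c_def enn2real_positive_iff)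
  define k where "k = exp (- 1) * (1 - exp (- ?\<Psi> 1))"
  define K where "K = ?\<Psi> 2 + 1 + 2 * c"
  have k: "0 < k" using \<Psi>(2)[of 1] by (simp add: k_def)
  have K: "0 < K" "ennreal K = ennreal (?\<Psi> 2) + 1 + 2 * ennreal c"
    using \<Psi>(2)[of 2] c(2) by (auto simp: K_def ennreal_plus ennreal_mult)
  have main: "k / c * (r powr s * reciprocal_integral s (r powr (- s))) \<le> enn2real (mean_potential s r)
      \<and> enn2real (mean_potential s r) \<le> K / c * (r powr s * reciprocal_integral s (r powr (- s)))"
    if r: "0 < r" "2 \<le> r powr (- s)" for r
  proof -
    define m where "m = enn2real (mean_potential s r)"
    have m: "mean_potential s r = ennreal m" "0 \<le> m"
      using mean_potential_le_1[OF s r(1)] by (auto simp: m_def ennreal_enn2real_if top_unique)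
    define J where "J = reciprocal_integral s (r powr (- s))"
    have J: "inverse_integral ?\<Psi> (r powr (- s)) = ennreal J" "0 \<le> J"
      using reciprocal_integral_bounds[OF s, of "r powr (- s)"] r by (auto simp: J_def)
    have eq: "ennreal (c * m) = ennreal (r powr s) * smoothed_sojourn s ?\<Psi> r"
      using mean_potential_eq[OF s r(1)] c m by (simp add: ennreal_mult)
    have "ennreal (r powr s * (k * J)) = ennreal (r powr s) * (ennreal k * inverse_integral ?\<Psi> (r powr (- s)))"
      using J k by (simp add: ennreal_mult)
    also have "\<dots> \<le> ennreal (c * m)"
      unfolding eq k_def using smoothed_sojourn_ge[of ?\<Psi> s r] \<Psi> s r by (intro mult_left_mono) auto
    finally have 1: "r powr s * (k * J) \<le> c * m" using c m by simp
    have "ennreal (c * m) \<le> ennreal (r powr s) * (ennreal K * inverse_integral ?\<Psi> (r powr (- s)))"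
      unfolding eq K(2) c(1)[symmetric]
      using smoothed_sojourn_le[of ?\<Psi> s r] \<Psi> s r by (intro mult_left_mono) auto
    also have "\<dots> = ennreal (r powr s * (K * J))"
      using J K by (simp add: ennreal_mult)
    finally have 2: "c * m \<le> r powr s * (K * J)" using J K by simp
    show ?thesis
      unfolding m_def[symmetric] J_def[symmetric] using 1 2 c by (simp add: field_simps)
  qed
  show ?thesis
    by (rule that[of "k / c" "K / c"]) (use main k K c in auto)
qed

end

section \<open>Upper bound: equilibrium weights along the path\<close>

lemma (in prob_space) nn_integral_indep_mult:
  fixes X Y :: "'a \<Rightarrow> ennreal"
  assumes "indep_var borel X borel Y"
  shows "(\<integral>\<^sup>+\<omega>. X \<omega> * Y \<omega> \<partial>M) = (\<integral>\<^sup>+\<omega>. X \<omega> \<partial>M) * (\<integral>\<^sup>+\<omega>. Y \<omega> \<partial>M)"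
proof -
  have "case_bool borel borel = (\<lambda>_. borel :: ennreal measure)"
    by (auto simp: fun_eq_iff split: bool.split)
  then have "indep_vars (\<lambda>_. borel) (case_bool X Y) UNIV"
    using assms by (simp add: indep_var_def)
  then have "(\<integral>\<^sup>+\<omega>. (\<Prod>i\<in>UNIV. case_bool X Y i \<omega>) \<partial>M) = (\<Prod>i\<in>UNIV. \<integral>\<^sup>+\<omega>. case_bool X Y i \<omega> \<partial>M)"
    by (intro indep_vars_nn_integral) auto
  then show ?thesis
    by (simp add: UNIV_bool mult.commute)
qed

context regular_subordinator
begin

definition grid :: "nat \<Rightarrow> 'a \<Rightarrow> nat \<Rightarrow> real" where
  "grid N \<omega> k = S (real k / real N) \<omega>"

lemma grid_measurable [measurable]: "(\<lambda>\<omega>. grid N \<omega> k) \<in> borel_measurable M"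
  unfolding grid_def by (rule measurable_process) simp

lemma grid_mono: "\<omega> \<in> space M \<Longrightarrow> mono (grid N \<omega>)"
  unfolding grid_def by (auto intro!: monoI monotone_path divide_right_mono)

definition grid_weight :: "real \<Rightarrow> real \<Rightarrow> nat \<Rightarrow> 'a \<Rightarrow> nat \<Rightarrow> real" where
  "grid_weight s r N \<omega> k = first_hit_weight (smooth_kernel s r) (grid N \<omega>) k"

lemma grid_weight_measurable [measurable]: "(\<lambda>\<omega>. grid_weight s r N \<omega> k) \<in> borel_measurable M"
  unfolding grid_weight_def by (intro first_hit_weight_measurable) auto

lemma grid_weight_nonneg:
  assumes "0 < s" "0 < r" "\<omega> \<in> space M"
  shows "0 \<le> grid_weight s r N \<omega> k"
  unfolding grid_weight_def using assms
  by (intro first_hit_weight_nonneg grid_mono smooth_kernel_antimono) auto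

lemma grid_weight_potential:
  "(\<Sum>j\<le>k. smooth_kernel s r (grid N \<omega> k - grid N \<omega> j) * grid_weight s r N \<omega> j) = 1"
  unfolding grid_weight_def by (intro first_hit_weight_potential) simp

text \<open>
  The weight at step \<open>j\<close> is a function of the increments before step \<open>j\<close>, which are independent
  of the increment between the steps \<open>j\<close> and \<open>i\<close>; the latter has the law of the path at step
  \<open>i - j\<close>.
\<close>

lemma grid_weight_indep:
  assumes "j \<le> i"
  shows "(\<integral>\<^sup>+\<omega>. ennreal (grid_weight s r N \<omega> j) * ennreal (smooth_kernel s r (grid N \<omega> i - grid N \<omega> j)) \<partial>M)
    = (\<integral>\<^sup>+\<omega>. ennreal (grid_weight s r N \<omega> j) \<partial>M) * (\<integral>\<^sup>+\<omega>. ennreal (smooth_kernel s r (grid N \<omega> (i - j))) \<partial>M)"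
proof -
  (* The first j increments run along the grid; the increment with index j is the jump from
     step j to step i. *)
  define \<tau> where "\<tau> k = (if k \<le> j then real k / real N else real i / real N)" for k
  define D where "D k \<omega> = S (\<tau> (Suc k)) \<omega> - S (\<tau> k) \<omega>" for k \<omega>
  have "indep_vars (\<lambda>_. borel) D {..<Suc j}"
    unfolding D_def using assms
    by (intro independent_increments) (auto simp: \<tau>_def intro!: divide_right_mono)
  then have ind: "indep_var (PiM {..<j} (\<lambda>_. borel)) (\<lambda>\<omega>. restrict (\<lambda>k. D k \<omega>) {..<j})
      (PiM {j} (\<lambda>_. borel)) (\<lambda>\<omega>. restrict (\<lambda>k. D k \<omega>) {j})"
    by (rule indep_var_restrict) auto
  let ?f = "\<lambda>d. ennreal (first_hit_weight (smooth_kernel s r) (\<lambda>k. \<Sum>l<k. d l) j)"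
  let ?g = "\<lambda>d :: nat \<Rightarrow> real. ennreal (smooth_kernel s r (d j))"
  have f: "?f \<in> borel_measurable (PiM {..<j} (\<lambda>_. borel))"
  proof (intro measurable_compose[OF _ measurable_ennreal] first_hit_weight_measurable)
    show "(\<lambda>d. \<Sum>l<k. d l) \<in> borel_measurable (PiM {..<j} (\<lambda>_. borel :: real measure))" if "k \<le> j" for k
      using that by (intro borel_measurable_sum measurable_component_singleton) auto
  qed simp
  have g: "?g \<in> borel_measurable (PiM {j} (\<lambda>_. borel))"
    by measurable
  have partial: "(\<Sum>l<k. restrict (\<lambda>k. D k \<omega>) {..<j} l) = grid N \<omega> k" if "k \<le> j" "\<omega> \<in> space M" for k \<omega>
  proof -
    have "(\<Sum>l<k. restrict (\<lambda>k. D k \<omega>) {..<j} l) = (\<Sum>l<k. grid N \<omega> (Suc l) - grid N \<omega> l)"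
      using that by (intro sum.cong) (auto simp: D_def \<tau>_def grid_def)
    also have "\<dots> = grid N \<omega> k - grid N \<omega> 0" by (rule sum_lessThan_telescope)
    also have "grid N \<omega> 0 = 0" using that by (simp add: grid_def start)
    finally show ?thesis by simp
  qed
  have fD: "?f (restrict (\<lambda>k. D k \<omega>) {..<j}) = ennreal (grid_weight s r N \<omega> j)" if "\<omega> \<in> space M" for \<omega>
    unfolding grid_weight_def
    by (intro arg_cong[where f = ennreal] first_hit_weight_cong partial that)
  have gD: "?g (restrict (\<lambda>k. D k \<omega>) {j}) = ennreal (smooth_kernel s r (grid N \<omega> i - grid N \<omega> j))" for \<omega>
    by (simp add: D_def \<tau>_def grid_def)
  have "(\<integral>\<^sup>+\<omega>. ?f (restrict (\<lambda>k. D k \<omega>) {..<j}) * ?g (restrict (\<lambda>k. D k \<omega>) {j}) \<partial>M)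
      = (\<integral>\<^sup>+\<omega>. ?f (restrict (\<lambda>k. D k \<omega>) {..<j}) \<partial>M) * (\<integral>\<^sup>+\<omega>. ?g (restrict (\<lambda>k. D k \<omega>) {j}) \<partial>M)"
    using indep_var_compose[OF ind f g] by (intro nn_integral_indep_mult) (simp add: comp_def)
  then have "(\<integral>\<^sup>+\<omega>. ennreal (grid_weight s r N \<omega> j) * ennreal (smooth_kernel s r (grid N \<omega> i - grid N \<omega> j)) \<partial>M)
      = (\<integral>\<^sup>+\<omega>. ennreal (grid_weight s r N \<omega> j) \<partial>M) * (\<integral>\<^sup>+\<omega>. ennreal (smooth_kernel s r (grid N \<omega> i - grid N \<omega> j)) \<partial>M)"
    by (simp only: fD gD cong: nn_integral_cong)
  also have "(\<integral>\<^sup>+\<omega>. ennreal (smooth_kernel s r (grid N \<omega> i - grid N \<omega> j)) \<partial>M)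
      = (\<integral>\<^sup>+\<omega>. ennreal (smooth_kernel s r (grid N \<omega> (i - j))) \<partial>M)"
  proof -
    have "real i / real N - real j / real N = real (i - j) / real N"
      using assms by (simp add: of_nat_diff diff_divide_distrib)
    then show ?thesis
      unfolding grid_def
      by (subst nn_integral_increment[where f = "\<lambda>x. ennreal (smooth_kernel s r x)"])
         (use assms in \<open>auto intro!: divide_right_mono\<close>)
  qed
  finally show ?thesis .
qed

text \<open>
  The expected kernel decreases in time, so left Riemann sums dominate its integral.
\<close>

lemma mean_potential_le_grid_sum:
  assumes s: "0 < s" and r: "0 < r" and N: "0 < N"
  shows "mean_potential s r \<le> ennreal (1 / real N) * (\<Sum>l<N. \<integral>\<^sup>+\<omega>. ennreal (smooth_kernel s r (grid N \<omega> l)) \<partial>M)"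
proof -
  let ?G = "\<lambda>l. \<integral>\<^sup>+\<omega>. ennreal (smooth_kernel s r (grid N \<omega> l)) \<partial>M"
  let ?I = "\<lambda>l. {real l / real N..real (Suc l) / real N}"
  have "mean_potential s r \<le> (\<integral>\<^sup>+u. (\<Sum>l<N. ?G l * indicator (?I l) u) \<partial>lborel)"
    unfolding mean_potential_def
  proof (intro nn_integral_mono)
    fix u :: real
    show "indicator {0..1} u * (\<integral>\<^sup>+\<omega>. ennreal (smooth_kernel s r (S (max 0 u) \<omega>)) \<partial>M)
      \<le> (\<Sum>l<N. ?G l * indicator (?I l) u)"
    proof (cases "u \<in> {0..1}")
      case u: True
      obtain l where l: "l < N" "u \<in> ?I l"
      proof (cases "u = 1")
        case True
        then show ?thesis using N by (intro that[of "N - 1"]) (auto simp: of_nat_diff)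
      next
        case False
        define l where "l = nat \<lfloor>u * real N\<rfloor>"
        have l: "real l \<le> u * real N" "u * real N < real l + 1"
          using u by (auto simp: l_def)
        have "u * real N < real N" using u False N by simp
        then have "l < N" using l(1) by linarith
        then show ?thesis using l N by (intro that[of l]) (auto simp: field_simps)
      qed
      have "(\<integral>\<^sup>+\<omega>. ennreal (smooth_kernel s r (S (max 0 u) \<omega>)) \<partial>M) \<le> ?G l"
        unfolding grid_def using l u s r
        by (intro nn_integral_mono ennreal_leI smooth_kernel_antimono)
           (auto intro!: monotone_path path_nonneg)
      also have "\<dots> = ?G l * indicator (?I l) u" using l by simp
      also have "\<dots> \<le> (\<Sum>l<N. ?G l * indicator (?I l) u)"
        using l by (intro member_le_sum) auto
      finally show ?thesis using u by simp
    qed simp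
  qed
  also have "\<dots> = (\<Sum>l<N. ?G l * emeasure lborel (?I l))"
    by (subst nn_integral_sum) (auto simp: nn_integral_cmult_indicator)
  also have "\<dots> = (\<Sum>l<N. ?G l * ennreal (1 / real N))"
    using N by (intro sum.cong refl) (auto simp: divide_right_mono diff_divide_distrib[symmetric])
  finally show ?thesis by (simp add: sum_distrib_left mult.commute)
qed

text \<open>
  Count the total potential at the first \<open>2 * N\<close> sample points in two ways. It is \<open>2 * N\<close> by the
  choice of the weights. On the other hand, by independence and stationarity each of the first
  \<open>N + 1\<close> weights contributes to the \<open>N\<close> sample points starting with its own, in expectation,
  its mean times at least \<open>N * mean_potential s r\<close>.
\<close>

lemma expected_grid_weight:
  assumes s: "0 < s" and r: "0 < r" and N: "0 < N"
  shows "mean_potential s r * (\<integral>\<^sup>+\<omega>. (\<Sum>j\<le>N. ennreal (grid_weight s r N \<omega> j)) \<partial>M) \<le> 2"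
proof -
  let ?w = "\<lambda>\<omega> j. ennreal (grid_weight s r N \<omega> j)"
  let ?\<phi> = "\<lambda>\<omega> i j. ennreal (smooth_kernel s r (grid N \<omega> i - grid N \<omega> j))"
  let ?G = "\<lambda>l. \<integral>\<^sup>+\<omega>. ennreal (smooth_kernel s r (grid N \<omega> l)) \<partial>M"
  let ?W = "\<lambda>j. \<integral>\<^sup>+\<omega>. ?w \<omega> j \<partial>M"
  have pointwise: "(\<Sum>j\<le>N. \<Sum>i=j..<j + N. ?w \<omega> j * ?\<phi> \<omega> i j) \<le> ennreal (2 * real N)" if \<omega>: "\<omega> \<in> space M" for \<omega>
  proof -
    have "(\<Sum>j\<le>N. \<Sum>i=j..<j + N. ?w \<omega> j * ?\<phi> \<omega> i j) = (\<Sum>(j, i)\<in>(SIGMA j:{..N}. {j..<j + N}). ?w \<omega> j * ?\<phi> \<omega> i j)"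
      by (simp add: sum.Sigma)
    also have "\<dots> = (\<Sum>(i, j)\<in>(\<lambda>(j, i). (i, j)) ` (SIGMA j:{..N}. {j..<j + N}). ?w \<omega> j * ?\<phi> \<omega> i j)"
      by (subst sum.reindex) (auto simp: inj_on_def case_prod_beta)
    also have "\<dots> \<le> (\<Sum>(i, j)\<in>(SIGMA i:{..<2 * N}. {..i}). ?w \<omega> j * ?\<phi> \<omega> i j)"
      by (intro sum_mono2) auto
    also have "\<dots> = (\<Sum>i<2 * N. \<Sum>j\<le>i. ?w \<omega> j * ?\<phi> \<omega> i j)"
      by (simp add: sum.Sigma)
    also have "\<dots> = (\<Sum>i<2 * N. 1)"
    proof (intro sum.cong refl)
      fix i
      have "(\<Sum>j\<le>i. ?w \<omega> j * ?\<phi> \<omega> i j) = ennreal (\<Sum>j\<le>i. smooth_kernel s r (grid N \<omega> i - grid N \<omega> j) * grid_weight s r N \<omega> j)"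
        using grid_weight_nonneg[OF s r \<omega>]
        by (subst sum_ennreal[symmetric]) (auto simp: ennreal_mult mult.commute)
      then show "(\<Sum>j\<le>i. ?w \<omega> j * ?\<phi> \<omega> i j) = 1" by (simp add: grid_weight_potential)
    qed
    also have "\<dots> = ennreal (2 * real N)" by (simp add: ennreal_of_nat_eq_real_of_nat ennreal_mult)
    finally show ?thesis .
  qed
  (* The pairs with j <= N and j <= i < j + N form a subset of those with j <= i < 2 * N. *)
  have "(\<Sum>j\<le>N. ?W j) * (\<Sum>l<N. ?G l) = (\<Sum>j\<le>N. \<Sum>i=j..<j + N. ?W j * ?G (i - j))"
  proof (subst sum_distrib_right, intro sum.cong refl)
    fix j
    have "(\<Sum>i=j..<j + N. ?G (i - j)) = (\<Sum>l<N. ?G l)"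
      by (rule sum.reindex_bij_witness[of _ "\<lambda>l. l + j" "\<lambda>i. i - j"]) auto
    then show "?W j * (\<Sum>l<N. ?G l) = (\<Sum>i=j..<j + N. ?W j * ?G (i - j))"
      by (simp add: sum_distrib_left[symmetric])
  qed
  also have "\<dots> = (\<integral>\<^sup>+\<omega>. (\<Sum>j\<le>N. \<Sum>i=j..<j + N. ?w \<omega> j * ?\<phi> \<omega> i j) \<partial>M)"
    by (simp add: nn_integral_sum grid_weight_indep)
  also have "\<dots> \<le> (\<integral>\<^sup>+\<omega>. ennreal (2 * real N) \<partial>M)"
    by (intro nn_integral_mono pointwise)
  also have "\<dots> = ennreal (2 * real N)" by (simp add: emeasure_space_1)
  finally have main: "(\<Sum>j\<le>N. ?W j) * (\<Sum>l<N. ?G l) \<le> ennreal (2 * real N)" .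
  have "mean_potential s r * (\<integral>\<^sup>+\<omega>. (\<Sum>j\<le>N. ?w \<omega> j) \<partial>M)
      \<le> (ennreal (1 / real N) * (\<Sum>l<N. ?G l)) * (\<Sum>j\<le>N. ?W j)"
    by (subst nn_integral_sum) (auto intro!: mult_right_mono mean_potential_le_grid_sum s r N)
  also have "\<dots> = ennreal (1 / real N) * ((\<Sum>j\<le>N. ?W j) * (\<Sum>l<N. ?G l))"
    by (simp add: mult_ac)
  also have "\<dots> \<le> ennreal (1 / real N) * ennreal (2 * real N)"
    by (intro mult_left_mono main) auto
  also have "\<dots> = 2" using N by (simp flip: ennreal_mult')
  finally show ?thesis .
qed

text \<open>
  A lower limit over finer and finer grids. It satisfies the expectation bound by Fatou's lemma,
  and arbitrarily fine grids have a total weight close to it.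
\<close>

definition limit_weight :: "real \<Rightarrow> real \<Rightarrow> 'a \<Rightarrow> ennreal" where
  "limit_weight s r \<omega> = liminf (\<lambda>K. \<Sum>j\<le>2 ^ K. ennreal (grid_weight s r (2 ^ K) \<omega> j))"

lemma limit_weight_measurable [measurable]: "limit_weight s r \<in> borel_measurable M"
  unfolding limit_weight_def by measurable

lemma expected_limit_weight:
  assumes s: "0 < s" and r: "0 < r"
  shows "mean_potential s r * (\<integral>\<^sup>+\<omega>. limit_weight s r \<omega> \<partial>M) \<le> 2"
proof -
  have "mean_potential s r * (\<integral>\<^sup>+\<omega>. limit_weight s r \<omega> \<partial>M) = (\<integral>\<^sup>+\<omega>. mean_potential s r * limit_weight s r \<omega> \<partial>M)"
    by (simp add: nn_integral_cmult)
  also have "\<dots> \<le> (\<integral>\<^sup>+\<omega>. liminf (\<lambda>K. mean_potential s r * (\<Sum>j\<le>2 ^ K. ennreal (grid_weight s r (2 ^ K) \<omega> j))) \<partial>M)"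
  proof (intro nn_integral_mono)
    fix \<omega>
    show "mean_potential s r * limit_weight s r \<omega>
        \<le> liminf (\<lambda>K. mean_potential s r * (\<Sum>j\<le>2 ^ K. ennreal (grid_weight s r (2 ^ K) \<omega> j)))"
      unfolding limit_weight_def liminf_SUP_INF SUP_mult_left_ennreal
      by (intro SUP_mono) (auto intro!: INF_greatest mult_left_mono INF_lower)
  qed
  also have "\<dots> \<le> liminf (\<lambda>K. \<integral>\<^sup>+\<omega>. mean_potential s r * (\<Sum>j\<le>2 ^ K. ennreal (grid_weight s r (2 ^ K) \<omega> j)) \<partial>M)"
    by (intro nn_integral_liminf) measurable
  also have "\<dots> = liminf (\<lambda>K. mean_potential s r * (\<integral>\<^sup>+\<omega>. (\<Sum>j\<le>2 ^ K. ennreal (grid_weight s r (2 ^ K) \<omega> j)) \<partial>M))"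
    by (simp add: nn_integral_cmult)
  also have "\<dots> \<le> liminf (\<lambda>K. 2 :: ennreal)"
    by (intro Liminf_mono always_eventually allI expected_grid_weight s r) simp
  also have "\<dots> = 2" by (simp add: Liminf_const)
  finally show ?thesis .
qed

text \<open>
  Cover the relatively compact range by finitely many small balls; by right-continuity every
  centre is approximated by a sample point once the grid is fine enough.
\<close>

lemma grid_is_net:
  assumes \<omega>: "\<omega> \<in> space M" and r: "0 < r"
  shows "\<forall>\<^sub>F K in sequentially. \<forall>t\<in>{0..1}. \<exists>i\<le>2 ^ K. \<bar>S t \<omega> - grid (2 ^ K) \<omega> i\<bar> \<le> r"
proof -
  let ?F = "(\<lambda>t. S t \<omega>) ` {0..1}"
  have "?F \<subseteq> {0..S 1 \<omega>}" using \<omega> by (auto intro: path_nonneg monotone_path)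
  then have "bounded ?F" by (rule bounded_subset[OF bounded_closed_interval])
  then have "seq_compact (closure ?F)" by (simp add: compact_imp_seq_compact)
  then obtain C where C: "finite C" "C \<subseteq> closure ?F" "closure ?F \<subseteq> (\<Union>x\<in>C. ball x (r / 4))"
    using seq_compact_imp_totally_bounded r by (metis divide_pos_pos zero_less_numeral)
  have near: "\<forall>\<^sub>F K in sequentially. \<exists>i\<le>2 ^ K. \<bar>c - grid (2 ^ K) \<omega> i\<bar> < r / 2" if "c \<in> C" for c
  proof -
    have "c \<in> closure ?F" using C that by auto
    then obtain t where t: "0 \<le> t" "t \<le> 1" "\<bar>S t \<omega> - c\<bar> < r / 4"
      using r by (auto simp: closure_approachable dist_real_def dest!: spec[of _ "r / 4"])
    obtain d where d: "0 < d" "\<And>u. t \<le> u \<Longrightarrow> u < t + d \<Longrightarrow> \<bar>S u \<omega> - S t \<omega>\<bar> < r / 4"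
      using right_continuousE[OF \<omega> t(1), of "r / 4"] r by auto
    have "(\<lambda>K. (1 / 2 :: real) ^ K) \<longlonglongrightarrow> 0" by (intro LIMSEQ_power_zero) simp
    then have "\<forall>\<^sub>F K in sequentially. (1 / 2 :: real) ^ K < d" using d(1) by (rule order_tendstoD)
    then show ?thesis
    proof eventually_elim
      case (elim K)
      define i where "i = nat \<lceil>t * 2 ^ K\<rceil>"
      have i: "real i = of_int \<lceil>t * 2 ^ K\<rceil>" unfolding i_def using t by simp
      have "\<lceil>t * 2 ^ K\<rceil> \<le> 2 ^ K"
        using t by (simp add: ceiling_le_iff)
      then have le: "i \<le> 2 ^ K" unfolding i_def by (simp add: nat_le_iff)
      have "t * 2 ^ K \<le> real i" "real i < t * 2 ^ K + 1" unfolding i by linarith+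
      then have "t \<le> real i / real (2 ^ K)" "real i / real (2 ^ K) < t + (1 / 2) ^ K"
        by (simp_all add: field_simps power_one_over)
      then have "\<bar>grid (2 ^ K) \<omega> i - S t \<omega>\<bar> < r / 4"
        unfolding grid_def using elim by (intro d) auto
      then have "\<bar>c - grid (2 ^ K) \<omega> i\<bar> < r / 2" using t(3) by linarith
      then show ?case using le by blast
    qed
  qed
  have "\<forall>\<^sub>F K in sequentially. \<forall>c\<in>C. \<exists>i\<le>2 ^ K. \<bar>c - grid (2 ^ K) \<omega> i\<bar> < r / 2"
    by (rule eventually_ball_finite[OF C(1)]) (use near in blast)
  then show ?thesis
  proof eventually_elim
    case (elim K)
    show ?case
    proof
      fix t :: real assume "t \<in> {0..1}"
      then have "S t \<omega> \<in> closure ?F" by (intro subsetD[OF closure_subset] imageI)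
      then have "S t \<omega> \<in> (\<Union>x\<in>C. ball x (r / 4))" using C(3) by (rule subsetD[rotated])
      then obtain c where c: "c \<in> C" "dist c (S t \<omega>) < r / 4" by (auto simp: mem_ball)
      then obtain i where i: "i \<le> 2 ^ K" "\<bar>c - grid (2 ^ K) \<omega> i\<bar> < r / 2" using elim by blast
      have "\<bar>S t \<omega> - grid (2 ^ K) \<omega> i\<bar> \<le> r" using c(2) i(2) unfolding dist_real_def by linarith
      then show "\<exists>i\<le>2 ^ K. \<bar>S t \<omega> - grid (2 ^ K) \<omega> i\<bar> \<le> r" using i(1) by blast
    qed
  qed
qed

lemma measure_low_density_limit_weight:
  assumes \<omega>: "\<omega> \<in> space M" and s: "0 < s" and r: "0 < r"
    and fin: "finite_measure \<mu>" "sets \<mu> = sets borel"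
    and A: "A \<in> sets borel" "A \<subseteq> (\<lambda>t. S t \<omega>) ` {0..1}"
    and low: "\<And>x. x \<in> A \<Longrightarrow> profile_kernel s \<mu> x r \<le> b" and b: "0 \<le> b"
    and W: "limit_weight s r \<omega> < ennreal W" "0 \<le> W"
  shows "measure \<mu> A \<le> 4 powr s * b * W"
proof -
  have "\<exists>\<^sub>F K in sequentially. (\<Sum>j\<le>2 ^ K. ennreal (grid_weight s r (2 ^ K) \<omega> j)) < ennreal W"
  proof (rule ccontr)
    assume "\<not> ?thesis"
    then have "ennreal W \<le> limit_weight s r \<omega>"
      unfolding limit_weight_def by (intro Liminf_bounded) (simp add: not_frequently not_less)
    then show False using W by simp
  qed
  from frequently_ex[OF frequently_eventually_frequently[OF this grid_is_net[OF \<omega> r]]]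
  obtain K where K: "(\<Sum>j\<le>2 ^ K. ennreal (grid_weight s r (2 ^ K) \<omega> j)) < ennreal W"
    "\<And>t. t \<in> {0..1} \<Longrightarrow> \<exists>i\<le>2 ^ K. \<bar>S t \<omega> - grid (2 ^ K) \<omega> i\<bar> \<le> r"
    by blast
  let ?w = "grid_weight s r (2 ^ K) \<omega>" and ?y = "grid (2 ^ K) \<omega>"
  have w: "0 \<le> ?w j" for j using grid_weight_nonneg s r \<omega> by blast
  have "measure \<mu> A \<le> 4 powr s * b * (\<Sum>j\<le>2 ^ K. ?w j)"
  proof (rule measure_low_density_le[OF fin s r _ w _ A low b])
    show "\<exists>i\<le>2 ^ K. \<bar>x - ?y i\<bar> \<le> r" if "x \<in> (\<lambda>t. S t \<omega>) ` {0..1}" for x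
      using K(2) that by blast
    show "1 \<le> (\<Sum>j\<le>2 ^ K. smooth_kernel s r \<bar>?y i - ?y j\<bar> * ?w j)" if "i \<le> 2 ^ K" for i
    proof -
      have "1 = (\<Sum>j\<le>i. smooth_kernel s r (?y i - ?y j) * ?w j)"
        by (simp add: grid_weight_potential)
      also have "\<dots> = (\<Sum>j\<le>i. smooth_kernel s r \<bar>?y i - ?y j\<bar> * ?w j)"
        using grid_mono[OF \<omega>] by (intro sum.cong) (auto simp: mono_def)
      also have "\<dots> \<le> (\<Sum>j\<le>2 ^ K. smooth_kernel s r \<bar>?y i - ?y j\<bar> * ?w j)"
        using that w by (intro sum_mono2) auto
      finally show ?thesis .
    qed
  qed
  also have "\<dots> \<le> 4 powr s * b * W"
  proof (intro mult_left_mono)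
    show "(\<Sum>j\<le>2 ^ K. ?w j) \<le> W" using K(1) w W(2) by (simp add: sum_ennreal ennreal_less_iff sum_nonneg)
  qed (use b in auto)
  finally show ?thesis .
qed

text \<open>
  The sets where the potential of \<open>\<mu>\<close> at scale \<open>(1/2) ^ n\<close> is at most \<open>((1/2) ^ n) powr t\<close> have
  summable measures, with a bound that depends on \<open>\<mu>\<close> only through the property that it is
  carried by the range. By Borel--Cantelli, the lower limit in the definition of the dimension
  of \<open>\<mu>\<close> is positive almost everywhere for every exponent above \<open>t\<close>.
\<close>

lemma Dim_FH_range_le:
  assumes \<omega>: "\<omega> \<in> space M" and s: "0 < s" and t: "0 < t"
    and fin: "(\<Sum>n. ennreal (((1 / 2) ^ n) powr t) * limit_weight s ((1 / 2) ^ n) \<omega>) < \<infinity>"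
  shows "Dim_FH s ((\<lambda>t. S t \<omega>) ` {0..1}) \<le> ereal t"
proof -
  let ?F = "(\<lambda>t. S t \<omega>) ` {0..1}"
  define W where "W n = enn2real (limit_weight s ((1 / 2) ^ n) \<omega>)" for n
  have W: "limit_weight s ((1 / 2) ^ n) \<omega> = ennreal (W n)" "0 \<le> W n" for n
  proof -
    have "ennreal (((1 / 2) ^ n) powr t) * limit_weight s ((1 / 2) ^ n) \<omega> < \<top>"
      using fin by (intro ennreal_suminf_lessD[where f = "\<lambda>n. ennreal (((1 / 2) ^ n) powr t) * limit_weight s ((1 / 2) ^ n) \<omega>"]) auto
    then have "limit_weight s ((1 / 2) ^ n) \<omega> < \<top>"
      by (auto simp: ennreal_mult_less_top)
    then show "limit_weight s ((1 / 2) ^ n) \<omega> = ennreal (W n)" "0 \<le> W n" by (auto simp: W_def)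
  qed
  have sum1: "summable (\<lambda>n. ((1 / 2) ^ n) powr t * W n)"
    using fin W by (intro summable_suminf_not_top) (auto simp: ennreal_mult)
  have "norm ((1 / 2 :: real) powr t) < 1" using t by (simp add: powr01_less_one)
  then have "summable (\<lambda>n. ((1 / 2 :: real) powr t) ^ n)" by (rule summable_geometric)
  then have sum2: "summable (\<lambda>n. ((1 / 2 :: real) ^ n) powr t)"
    by (simp add: powr_powr mult.commute flip: powr_realpow)
  have sum: "summable (\<lambda>n. 4 powr s * ((1 / 2) ^ n) powr t * (W n + 1))"
    using summable_mult[OF summable_add[OF sum1 sum2], of "4 powr s"] by (simp add: algebra_simps)
  have "t' \<le> t" if \<mu>: "finite_measure \<mu>" "sets \<mu> = sets borel" "emeasure \<mu> UNIV \<noteq> 0"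
      "measure_support \<mu> \<subseteq> ?F"
    and t': "AE x in \<mu>. Liminf (at_right 0) (\<lambda>r. ereal (r powr (- t') * profile_kernel s \<mu> x r)) = 0" for \<mu> t'
  proof (rule ccontr)
    assume "\<not> t' \<le> t"
    interpret finite_measure \<mu> by fact
    note [measurable_cong] = \<mu>(2)
    note [measurable] = profile_kernel_measurable[OF \<mu>(1,2)]
    have [measurable]: "measure_support \<mu> \<in> sets borel"
      using closed_measure_support by (rule borel_closed)
    define A where "A n = measure_support \<mu> \<inter> {x. profile_kernel s \<mu> x ((1 / 2) ^ n) \<le> ((1 / 2) ^ n) powr t}" for n
    have A [measurable]: "A n \<in> sets borel" for n unfolding A_def by measurable
    have le: "measure \<mu> (A n) \<le> 4 powr s * ((1 / 2) ^ n) powr t * (W n + 1)" for n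
      using \<mu> W[of n]
      by (intro measure_low_density_limit_weight[OF \<omega> s _ \<mu>(1,2) A]) (auto simp: A_def ennreal_less_iff)
    have "summable (\<lambda>n. measure \<mu> (A n))"
      by (rule summable_comparison_test'[OF sum]) (use le in simp)
    then have "AE x in \<mu>. \<forall>\<^sub>F n in sequentially. x \<in> space \<mu> - A n"
      using A \<mu>(2) by (intro borel_cantelli_AE1) (auto simp: emeasure_eq_measure)
    moreover have "AE x in \<mu>. x \<in> measure_support \<mu>"
      using emeasure_compl_measure_support[OF \<mu>(2)] \<mu>(2) closed_measure_support[of \<mu>]
      by (intro AE_I[of _ _ "- measure_support \<mu>"]) auto
    ultimately have "AE x in \<mu>. False"
      using t'
    proof eventually_elim
      case (elim x)
      have "\<forall>\<^sub>F n in sequentially. ((1 / 2) ^ n) powr t < profile_kernel s \<mu> x ((1 / 2) ^ n)"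
        using elim(1) by eventually_elim (use elim(2) in \<open>auto simp: A_def\<close>)
      from Liminf_profile_pos[OF \<mu>(1,2) s t _ this, of t'] \<open>\<not> t' \<le> t\<close> elim(3)
      show ?case by simp
    qed
    then have "emeasure \<mu> (space \<mu>) = 0"
      by (simp add: AE_iff_measurable[OF sets.top])
    moreover have "space \<mu> = UNIV" using sets_eq_imp_space_eq[OF \<mu>(2)] by simp
    ultimately show False using \<mu>(3) by simp
  qed
  then show ?thesis
    unfolding Dim_FH_def Dim_FH_measure_def using t
    by (intro Sup_least) (auto intro!: Sup_least)
qed

lemma AE_Dim_FH_range_le:
  assumes s: "0 < s" and t: "0 < t"
    and sum: "summable (\<lambda>n. ((1 / 2) ^ n) powr t / enn2real (mean_potential s ((1 / 2) ^ n)))"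
  shows "AE \<omega> in M. Dim_FH s ((\<lambda>t. S t \<omega>) ` {0..1}) \<le> ereal t"
proof -
  define A where "A n = enn2real (mean_potential s ((1 / 2) ^ n))" for n
  have A: "mean_potential s ((1 / 2) ^ n) = ennreal (A n)" "0 < A n" for n
    using ennreal_mean_potential[OF s, of "(1 / 2) ^ n"] mean_potential_pos[OF s, of "(1 / 2) ^ n"]
      mean_potential_le_1[OF s, of "(1 / 2) ^ n"]
    by (auto simp: A_def enn2real_positive_iff intro: le_less_trans)
  have W: "(\<integral>\<^sup>+\<omega>. limit_weight s ((1 / 2) ^ n) \<omega> \<partial>M) \<le> ennreal (2 / A n)" for n
  proof -
    let ?E = "\<integral>\<^sup>+\<omega>. limit_weight s ((1 / 2) ^ n) \<omega> \<partial>M"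
    have "?E = ennreal (1 / A n) * (ennreal (A n) * ?E)"
      using A(2)[of n] by (simp add: mult.assoc[symmetric] flip: ennreal_mult')
    also have "\<dots> \<le> ennreal (1 / A n) * 2"
      using expected_limit_weight[OF s, of "(1 / 2) ^ n"] by (intro mult_left_mono) (auto simp: A(1))
    also have "\<dots> = ennreal (1 / A n) * ennreal 2" by simp
    also have "\<dots> = ennreal (2 / A n)"
      using A(2)[of n] by (subst ennreal_mult[symmetric]) auto
    finally show ?thesis .
  qed
  have "(\<integral>\<^sup>+\<omega>. (\<Sum>n. ennreal (((1 / 2) ^ n) powr t) * limit_weight s ((1 / 2) ^ n) \<omega>) \<partial>M)
      = (\<Sum>n. ennreal (((1 / 2) ^ n) powr t) * (\<integral>\<^sup>+\<omega>. limit_weight s ((1 / 2) ^ n) \<omega> \<partial>M))"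
    by (simp add: nn_integral_suminf nn_integral_cmult)
  also have "\<dots> \<le> (\<Sum>n. ennreal (2 * (((1 / 2) ^ n) powr t / A n)))"
  proof (intro suminf_le summableI)
    fix n
    have "ennreal (((1 / 2) ^ n) powr t) * (\<integral>\<^sup>+\<omega>. limit_weight s ((1 / 2) ^ n) \<omega> \<partial>M)
        \<le> ennreal (((1 / 2) ^ n) powr t) * ennreal (2 / A n)"
      by (intro mult_left_mono W) auto
    also have "\<dots> = ennreal (2 * (((1 / 2) ^ n) powr t / A n))"
      using A(2)[of n] by (subst ennreal_mult[symmetric]) (auto simp: mult.commute)
    finally show "ennreal (((1 / 2) ^ n) powr t) * (\<integral>\<^sup>+\<omega>. limit_weight s ((1 / 2) ^ n) \<omega> \<partial>M)
        \<le> ennreal (2 * (((1 / 2) ^ n) powr t / A n))" .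
  qed
  also have "\<dots> < \<infinity>"
    using summable_mult[OF sum, of 2] A(2) less_imp_le[OF A(2)]
    by (subst suminf_ennreal_eq[OF _ summable_sums]) (auto simp: A_def[symmetric])
  finally have "AE \<omega> in M. (\<Sum>n. ennreal (((1 / 2) ^ n) powr t) * limit_weight s ((1 / 2) ^ n) \<omega>) \<noteq> \<infinity>"
    by (intro nn_integral_PInf_AE) (auto simp: less_top)
  then show ?thesis
    using AE_space by eventually_elim (auto intro!: Dim_FH_range_le s t simp: less_top)
qed

section \<open>Lower bound: the occupation measure\<close>

text \<open>
  For times \<open>u\<close> and \<open>v\<close> the expected kernel depends only on \<open>\<bar>v - u\<bar>\<close>, and for fixed \<open>u\<close> in the
  unit interval the set of all \<open>v - u\<close> is covered by \<open>[0, 1]\<close> and \<open>[- 1, 0]\<close>.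
\<close>

lemma expected_energy:
  assumes s: "0 < s" and r: "0 < r"
  shows "(\<integral>\<^sup>+\<omega>. (\<integral>\<^sup>+u. indicator {0..1} u * (\<integral>\<^sup>+v. indicator {0..1} v
      * ennreal (smooth_kernel s r \<bar>S (max 0 v) \<omega> - S (max 0 u) \<omega>\<bar>) \<partial>lborel) \<partial>lborel) \<partial>M) \<le> 2 * mean_potential s r"
proof -
  interpret P: pair_sigma_finite lborel M
    by (intro pair_sigma_finite.intro sigma_finite_lborel sigma_finite_measure_axioms)
  let ?\<phi> = "\<lambda>\<omega> u v. ennreal (smooth_kernel s r \<bar>S (max 0 v) \<omega> - S (max 0 u) \<omega>\<bar>)"
  let ?g = "\<lambda>d. \<integral>\<^sup>+\<omega>. ennreal (smooth_kernel s r (S (max 0 d) \<omega>)) \<partial>M"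
  let ?h = "\<lambda>d. indicator {0..1} d * ?g d"
  have pair: "(\<integral>\<^sup>+\<omega>. ?\<phi> \<omega> u v \<partial>M) \<le> ?g \<bar>v - u\<bar>" if "0 \<le> u" "0 \<le> v" for u v
  proof -
    have *: "(\<integral>\<^sup>+\<omega>. ennreal (smooth_kernel s r \<bar>S b \<omega> - S a \<omega>\<bar>) \<partial>M) = ?g (b - a)" if "0 \<le> a" "a \<le> b" for a b
    proof -
      have "(\<integral>\<^sup>+\<omega>. ennreal (smooth_kernel s r \<bar>S b \<omega> - S a \<omega>\<bar>) \<partial>M)
          = (\<integral>\<^sup>+\<omega>. ennreal (smooth_kernel s r (S b \<omega> - S a \<omega>)) \<partial>M)"
        using that by (intro nn_integral_cong) (simp add: monotone_path)
      also have "\<dots> = (\<integral>\<^sup>+\<omega>. ennreal (smooth_kernel s r (S (b - a) \<omega>)) \<partial>M)"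
        using that by (intro nn_integral_increment[where f = "\<lambda>x. ennreal (smooth_kernel s r x)"]) auto
      finally show ?thesis using that by (simp add: max_def)
    qed
    show ?thesis
    proof (cases "u \<le> v")
      case True
      then show ?thesis using *[of u v] that by simp
    next
      case False
      then show ?thesis using *[of v u] that by (simp add: abs_minus_commute)
    qed
  qed
  have shift: "(\<integral>\<^sup>+v. ?h (v - u) \<partial>lborel) = mean_potential s r" "(\<integral>\<^sup>+v. ?h (u - v) \<partial>lborel) = mean_potential s r" for u
  proof -
    have "mean_potential s r = (\<integral>\<^sup>+v. ?h (- u + 1 * v) \<partial>lborel)"
      unfolding mean_potential_def by (subst nn_integral_real_affine[where t = "- u" and c = 1]) auto
    then show "(\<integral>\<^sup>+v. ?h (v - u) \<partial>lborel) = mean_potential s r" by simp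
    have "mean_potential s r = (\<integral>\<^sup>+v. ?h (u + (- 1) * v) \<partial>lborel)"
      unfolding mean_potential_def by (subst nn_integral_real_affine[where t = u and c = "- 1"]) auto
    then show "(\<integral>\<^sup>+v. ?h (u - v) \<partial>lborel) = mean_potential s r" by simp
  qed
  have "(\<integral>\<^sup>+\<omega>. (\<integral>\<^sup>+u. indicator {0..1} u * (\<integral>\<^sup>+v. indicator {0..1} v * ?\<phi> \<omega> u v \<partial>lborel) \<partial>lborel) \<partial>M)
      = (\<integral>\<^sup>+u. (\<integral>\<^sup>+\<omega>. indicator {0..1} u * (\<integral>\<^sup>+v. indicator {0..1} v * ?\<phi> \<omega> u v \<partial>lborel) \<partial>M) \<partial>lborel)"
    by (rule P.Fubini') measurable
  also have "\<dots> \<le> (\<integral>\<^sup>+u. 2 * mean_potential s r * indicator {0..1} (u::real) \<partial>lborel)"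
  proof (intro nn_integral_mono)
    fix u :: real
    show "(\<integral>\<^sup>+\<omega>. indicator {0..1} u * (\<integral>\<^sup>+v. indicator {0..1} v * ?\<phi> \<omega> u v \<partial>lborel) \<partial>M)
        \<le> 2 * mean_potential s r * indicator {0..1} u"
    proof (cases "u \<in> {0..1}")
      case u: True
      have "(\<integral>\<^sup>+\<omega>. (\<integral>\<^sup>+v. indicator {0..1} v * ?\<phi> \<omega> u v \<partial>lborel) \<partial>M)
          = (\<integral>\<^sup>+v. (\<integral>\<^sup>+\<omega>. indicator {0..1} v * ?\<phi> \<omega> u v \<partial>M) \<partial>lborel)"
        by (rule P.Fubini') measurable
      also have "\<dots> \<le> (\<integral>\<^sup>+v. ?h (v - u) + ?h (u - v) \<partial>lborel)"
      proof (intro nn_integral_mono)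
        fix v :: real
        show "(\<integral>\<^sup>+\<omega>. indicator {0..1} v * ?\<phi> \<omega> u v \<partial>M) \<le> ?h (v - u) + ?h (u - v)"
        proof (cases "v \<in> {0..1}")
          case v: True
          have "(\<integral>\<^sup>+\<omega>. ?\<phi> \<omega> u v \<partial>M) \<le> ?g \<bar>v - u\<bar>" using u v by (intro pair) auto
          also have "\<dots> \<le> ?h (v - u) + ?h (u - v)"
          proof (cases "u \<le> v")
            case True
            then have "?g \<bar>v - u\<bar> = ?h (v - u)" using u v by simp
            then show ?thesis by simp
          next
            case False
            then have "?g \<bar>v - u\<bar> = ?h (u - v)" using u v by (simp add: abs_minus_commute)
            then show ?thesis by simp
          qed
          finally show ?thesis using v by simp
        qed simp
      qed
      also have "\<dots> = (\<integral>\<^sup>+v. ?h (v - u) \<partial>lborel) + (\<integral>\<^sup>+v. ?h (u - v) \<partial>lborel)"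
        by (rule nn_integral_add) measurable
      also have "\<dots> = 2 * mean_potential s r" by (simp only: shift mult_2)
      finally show ?thesis using u by simp
    qed simp
  qed
  also have "\<dots> = 2 * mean_potential s r" by (simp add: nn_integral_cmult)
  finally show ?thesis .
qed

text \<open>
  The measure that realizes the bound is the image of Lebesgue measure on a compact set \<open>T\<close> of
  times at which the path is continuous. Such sets with positive measure exist since a monotone
  path has only countably many discontinuities, and the image of \<open>T\<close> is a compact subset of the
  range.
\<close>

lemma le_Dim_FH_range:
  assumes \<omega>: "\<omega> \<in> space M" and s: "0 < s" and t: "0 \<le> t"
    and r: "\<And>n. 0 < r n" "r \<longlonglongrightarrow> 0"
    and fin: "AE u in lborel. u \<in> {0..1} \<longrightarrow> (\<Sum>n. ennreal (r n powr (- t)) *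
      (\<integral>\<^sup>+v. indicator {0..1} v * ennreal (smooth_kernel s (r n) \<bar>S (max 0 v) \<omega> - S (max 0 u) \<omega>\<bar>) \<partial>lborel)) < \<infinity>"
  shows "ereal t \<le> Dim_FH s ((\<lambda>t. S t \<omega>) ` {0..1})"
proof -
  (* Clipping times at 0 extends the path to a monotone function on the whole line. *)
  define X where "X u = S (max 0 u) \<omega>" for u
  have mono: "mono X" using \<omega> by (auto simp: X_def intro!: monoI monotone_path)
  have X [measurable]: "X \<in> borel_measurable borel" using mono by (rule borel_measurable_mono)
  have "countable {a. \<not> isCont X a}" using mono_on_ctble_discont[of UNIV X] mono by (simp add: mono_def mono_on_def)
  then have D: "{a. \<not> isCont X a} \<in> null_sets lborel" by (rule countable_imp_null_set_lborel)
  define B where "B = {0..1} - {a. \<not> isCont X a}"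
  have B [measurable]: "B \<in> sets borel" unfolding B_def using D by auto
  have eB: "emeasure lborel B = 1"
    unfolding B_def using D by (simp add: emeasure_Diff_null_set)
  obtain T where T: "closed T" "T \<subseteq> B" "B - T \<in> lmeasurable" "emeasure lebesgue (B - T) < ennreal 1"
    using sets_lebesgue_inner_closed[of B 1] B by auto
  have [measurable]: "T \<in> sets borel" using T(1) by (rule borel_closed)
  have eT: "emeasure lborel T \<noteq> 0"
  proof
    assume "emeasure lborel T = 0"
    then have "emeasure lborel (B - T) = emeasure lborel B"
      by (intro emeasure_Diff_null_set) auto
    then show False using T(4) eB by simp
  qed
  have eT1: "emeasure lborel T \<le> 1"
    using emeasure_mono[of T B lborel] T(2) eB by simp
  have "compact T" using T by (auto simp: compact_eq_bounded_closed B_def intro: bounded_subset[of "{0..1}"])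
  moreover have "continuous_on T X"
    using T(2) by (intro continuous_at_imp_continuous_on) (auto simp: B_def)
  ultimately have comp: "compact (X ` T)" by (rule compact_continuous_image[rotated])
  have XT: "X ` T \<subseteq> (\<lambda>t. S t \<omega>) ` {0..1}"
    using T(2) by (auto simp: X_def B_def max_def)
  define \<nu> where "\<nu> = density lborel (indicator T)"
  define \<mu> where "\<mu> = distr \<nu> borel X"
  have sets_\<nu> [measurable_cong]: "sets \<nu> = sets borel" by (simp add: \<nu>_def)
  have sets [simp]: "sets \<mu> = sets borel" by (simp add: \<mu>_def)
  have X\<nu>: "X \<in> borel_measurable \<nu>" by measurable
  have space_\<nu>: "space \<nu> = UNIV" by (simp add: \<nu>_def)
  have e\<nu>: "emeasure \<nu> C = emeasure lborel (T \<inter> C)" if "C \<in> sets borel" for C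
    unfolding \<nu>_def using that by (simp add: emeasure_density flip: indicator_inter_arith)
  have e\<mu>: "emeasure \<mu> C = emeasure lborel (T \<inter> X -` C)" if "C \<in> sets borel" for C
  proof -
    have "X -` C \<in> sets borel" using measurable_sets[OF X that] by simp
    then show ?thesis
      using that by (simp add: \<mu>_def emeasure_distr[OF X\<nu>] space_\<nu> e\<nu>)
  qed
  have fin_\<mu>: "finite_measure \<mu>"
  proof (rule finite_measureI)
    have "emeasure \<mu> (space \<mu>) = emeasure lborel T" by (simp add: \<mu>_def e\<mu>[unfolded \<mu>_def])
    then show "emeasure \<mu> (space \<mu>) \<noteq> \<infinity>" using eT1 by (auto simp: top_unique)
  qed
  have nz: "emeasure \<mu> UNIV \<noteq> 0" using eT by (simp add: e\<mu>)
  have supp: "measure_support \<mu> \<subseteq> X ` T"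
  proof
    fix x assume x: "x \<in> measure_support \<mu>"
    show "x \<in> X ` T"
    proof (rule ccontr)
      assume "x \<notin> X ` T"
      moreover have op: "open (- (X ` T))" using comp by (simp add: compact_imp_closed open_Compl)
      ultimately have "0 < emeasure \<mu> (- (X ` T))" using x by (auto simp: measure_support_def)
      moreover have "T \<inter> X -` (- (X ` T)) = {}" by auto
      ultimately show False using op by (simp add: e\<mu>)
    qed
  qed
  have supp_compact: "compact (measure_support \<mu>)"
    using compact_Int_closed[OF comp closed_measure_support[of \<mu>]] supp by (simp add: Int_absorb1)
  have kernel: "ennreal (profile_kernel s \<mu> (X u) \<rho>) \<le> ennreal (2 powr s)
      * (\<integral>\<^sup>+v. indicator {0..1} v * ennreal (smooth_kernel s \<rho> \<bar>X v - X u\<bar>) \<partial>lborel)" if \<rho>: "0 < \<rho>" for u \<rho>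
  proof -
    have "ennreal (profile_kernel s \<mu> (X u) \<rho>) = (\<integral>\<^sup>+y. profile_integrand s \<rho> (X u) y \<partial>\<mu>)"
      by (rule ennreal_profile_kernel[OF fin_\<mu> sets])
    also have "\<dots> = (\<integral>\<^sup>+v. profile_integrand s \<rho> (X u) (X v) \<partial>\<nu>)"
      unfolding \<mu>_def by (rule nn_integral_distr) measurable
    also have "\<dots> = (\<integral>\<^sup>+v. indicator T v * ennreal (profile_integrand s \<rho> (X u) (X v)) \<partial>lborel)"
      unfolding \<nu>_def by (rule nn_integral_density) measurable
    also have "\<dots> \<le> (\<integral>\<^sup>+v. ennreal (2 powr s) * (indicator {0..1} v * ennreal (smooth_kernel s \<rho> \<bar>X v - X u\<bar>)) \<partial>lborel)"
    proof (intro nn_integral_mono)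
      fix v
      have "ennreal (profile_integrand s \<rho> (X u) (X v)) \<le> ennreal (2 powr s * smooth_kernel s \<rho> \<bar>X v - X u\<bar>)"
        by (intro ennreal_leI profile_integrand_le_smooth_kernel s \<rho>)
      then show "indicator T v * ennreal (profile_integrand s \<rho> (X u) (X v))
          \<le> ennreal (2 powr s) * (indicator {0..1} v * ennreal (smooth_kernel s \<rho> \<bar>X v - X u\<bar>))"
        using T(2) by (cases "v \<in> T") (auto simp: B_def ennreal_mult)
    qed
    also have "\<dots> = ennreal (2 powr s) * (\<integral>\<^sup>+v. indicator {0..1} v * ennreal (smooth_kernel s \<rho> \<bar>X v - X u\<bar>) \<partial>lborel)"
      by (rule nn_integral_cmult) measurable
    finally show ?thesis .
  qed
  note [measurable] = profile_kernel_measurable[OF fin_\<mu> sets]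
  define Q where "Q x \<longleftrightarrow> (\<Sum>n. ennreal (r n powr (- t) * profile_kernel s \<mu> x (r n))) < \<infinity>" for x
  have [measurable]: "Measurable.pred borel Q" unfolding Q_def by measurable
  have "AE u in lborel. u \<in> T \<longrightarrow> Q (X u)"
    using fin
  proof eventually_elim
    case (elim u)
    show ?case
    proof
      assume "u \<in> T"
      then have "u \<in> {0..1}" using T(2) by (auto simp: B_def)
      let ?I = "\<lambda>n. \<integral>\<^sup>+v. indicator {0..1} v * ennreal (smooth_kernel s (r n) \<bar>X v - X u\<bar>) \<partial>lborel"
      have "(\<Sum>n. ennreal (r n powr (- t) * profile_kernel s \<mu> (X u) (r n)))
          \<le> (\<Sum>n. ennreal (2 powr s) * (ennreal (r n powr (- t)) * ?I n))"
      proof (intro suminf_le summableI)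
        fix n
        have "ennreal (r n powr (- t) * profile_kernel s \<mu> (X u) (r n))
            = ennreal (r n powr (- t)) * ennreal (profile_kernel s \<mu> (X u) (r n))" by (simp add: ennreal_mult)
        also have "\<dots> \<le> ennreal (r n powr (- t)) * (ennreal (2 powr s) * ?I n)"
          by (intro mult_left_mono kernel r) auto
        finally show "ennreal (r n powr (- t) * profile_kernel s \<mu> (X u) (r n))
            \<le> ennreal (2 powr s) * (ennreal (r n powr (- t)) * ?I n)" by (simp add: mult.left_commute)
      qed
      also have "\<dots> = ennreal (2 powr s) * (\<Sum>n. ennreal (r n powr (- t)) * ?I n)"
        by (rule ennreal_suminf_cmult)
      also have "\<dots> < \<infinity>"
        using elim \<open>u \<in> {0..1}\<close> by (auto simp: X_def ennreal_mult_less_top)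
      finally show "Q (X u)" unfolding Q_def .
    qed
  qed
  then have "AE u in lborel. 0 < (indicator T u :: ennreal) \<longrightarrow> Q (X u)"
    by eventually_elim (simp add: indicator_def)
  then have "AE u in \<nu>. Q (X u)"
    unfolding \<nu>_def by (subst AE_density) simp_all
  then have "AE x in \<mu>. Q x"
    unfolding \<mu>_def by (subst AE_distr_iff[OF X\<nu>]) (simp_all flip: pred_def)
  then have "AE x in \<mu>. Liminf (at_right 0) (\<lambda>r. ereal (r powr (- t) * profile_kernel s \<mu> x r)) = 0"
    unfolding Q_def
    by eventually_elim (rule Liminf_profile_eq_0[OF r])
  then have "ereal t \<le> Dim_FH_measure s \<mu>"
    unfolding Dim_FH_measure_def using t by (intro Sup_upper) auto
  also have "\<dots> \<le> Dim_FH s ((\<lambda>t. S t \<omega>) ` {0..1})"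
    unfolding Dim_FH_def using fin_\<mu> nz supp supp_compact XT by (intro Sup_upper) auto
  finally show ?thesis .
qed

lemma AE_le_Dim_FH_range:
  assumes s: "0 < s" and t: "0 \<le> t"
    and small: "\<And>e. 0 < e \<Longrightarrow> \<exists>r>0. r < e \<and> r powr (- t) * enn2real (mean_potential s r) \<le> e"
  shows "AE \<omega> in M. ereal t \<le> Dim_FH s ((\<lambda>t. S t \<omega>) ` {0..1})"
proof -
  have "\<forall>n. \<exists>r>0. r < (1 / 2) ^ n \<and> r powr (- t) * enn2real (mean_potential s r) \<le> (1 / 2) ^ n"
    using small by auto
  then obtain r where r: "\<And>n. 0 < r n" "\<And>n. r n < (1 / 2) ^ n"
    "\<And>n. r n powr (- t) * enn2real (mean_potential s (r n)) \<le> (1 / 2) ^ n"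
    by metis
  have lim: "r \<longlonglongrightarrow> 0"
  proof (rule tendsto_sandwich[of "\<lambda>_. 0" _ _ "\<lambda>n. (1 / 2) ^ n"])
    show "(\<lambda>n. (1 / 2 :: real) ^ n) \<longlonglongrightarrow> 0" by (intro LIMSEQ_power_zero) simp
  qed (use r in \<open>auto intro!: always_eventually less_imp_le\<close>)
  define I where "I \<omega> u n = (\<integral>\<^sup>+v. indicator {0..1} v * ennreal (smooth_kernel s (r n) \<bar>S (max 0 v) \<omega> - S (max 0 u) \<omega>\<bar>) \<partial>lborel)" for \<omega> u n
  have I_joint [measurable]: "(\<lambda>(\<omega>, u). I \<omega> u n) \<in> borel_measurable (M \<Otimes>\<^sub>M lborel)" for n
    unfolding I_def by measurable
  have I_path: "(\<lambda>u. I \<omega> u n) \<in> borel_measurable lborel" if "\<omega> \<in> space M" for \<omega> n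
    using measurable_Pair2[OF I_joint that] by simp
  have "(\<integral>\<^sup>+\<omega>. (\<integral>\<^sup>+u. (\<Sum>n. ennreal (r n powr (- t)) * (indicator {0..1} u * I \<omega> u n)) \<partial>lborel) \<partial>M)
      = (\<integral>\<^sup>+\<omega>. (\<Sum>n. ennreal (r n powr (- t)) * (\<integral>\<^sup>+u. indicator {0..1} u * I \<omega> u n \<partial>lborel)) \<partial>M)"
  proof (intro nn_integral_cong)
    fix \<omega> assume "\<omega> \<in> space M"
    note [measurable] = I_path[OF this]
    have "(\<integral>\<^sup>+u. (\<Sum>n. ennreal (r n powr (- t)) * (indicator {0..1} u * I \<omega> u n)) \<partial>lborel)
        = (\<Sum>n. \<integral>\<^sup>+u. ennreal (r n powr (- t)) * (indicator {0..1} u * I \<omega> u n) \<partial>lborel)"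
      by (rule nn_integral_suminf) measurable
    also have "\<dots> = (\<Sum>n. ennreal (r n powr (- t)) * (\<integral>\<^sup>+u. indicator {0..1} u * I \<omega> u n \<partial>lborel))"
      by (intro suminf_cong nn_integral_cmult) measurable
    finally show "(\<integral>\<^sup>+u. (\<Sum>n. ennreal (r n powr (- t)) * (indicator {0..1} u * I \<omega> u n)) \<partial>lborel)
        = (\<Sum>n. ennreal (r n powr (- t)) * (\<integral>\<^sup>+u. indicator {0..1} u * I \<omega> u n \<partial>lborel))" .
  qed
  also have "\<dots> = (\<Sum>n. \<integral>\<^sup>+\<omega>. ennreal (r n powr (- t)) * (\<integral>\<^sup>+u. indicator {0..1} u * I \<omega> u n \<partial>lborel) \<partial>M)"
    by (rule nn_integral_suminf) measurable
  also have "\<dots> = (\<Sum>n. ennreal (r n powr (- t)) * (\<integral>\<^sup>+\<omega>. (\<integral>\<^sup>+u. indicator {0..1} u * I \<omega> u n \<partial>lborel) \<partial>M))"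
    by (intro suminf_cong nn_integral_cmult) measurable
  also have "\<dots> \<le> (\<Sum>n. ennreal (2 * (1 / 2) ^ n))"
  proof (intro suminf_le summableI)
    fix n
    have "ennreal (r n powr (- t)) * (\<integral>\<^sup>+\<omega>. (\<integral>\<^sup>+u. indicator {0..1} u * I \<omega> u n \<partial>lborel) \<partial>M)
        \<le> ennreal (r n powr (- t)) * (2 * mean_potential s (r n))"
      unfolding I_def by (intro mult_left_mono expected_energy s r) auto
    also have "\<dots> = ennreal 2 * ennreal (r n powr (- t) * enn2real (mean_potential s (r n)))"
      by (subst ennreal_mean_potential[OF s r(1)]) (simp add: ennreal_mult mult.left_commute)
    also have "\<dots> \<le> ennreal 2 * ennreal ((1 / 2) ^ n)"
      by (intro mult_left_mono ennreal_leI r) auto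
    also have "\<dots> = ennreal (2 * (1 / 2) ^ n)" by (rule ennreal_mult[symmetric]) auto
    finally show "ennreal (r n powr (- t)) * (\<integral>\<^sup>+\<omega>. (\<integral>\<^sup>+u. indicator {0..1} u * I \<omega> u n \<partial>lborel) \<partial>M)
        \<le> ennreal (2 * (1 / 2) ^ n)" .
  qed
  also have "\<dots> < \<infinity>"
    by (subst suminf_ennreal_eq[OF _ sums_mult[OF geometric_sums]]) auto
  finally have "(\<integral>\<^sup>+\<omega>. (\<integral>\<^sup>+u. (\<Sum>n. ennreal (r n powr (- t)) * (indicator {0..1} u * I \<omega> u n)) \<partial>lborel) \<partial>M) \<noteq> \<infinity>"
    by (rule less_imp_neq)
  then have "AE \<omega> in M. (\<integral>\<^sup>+u. (\<Sum>n. ennreal (r n powr (- t)) * (indicator {0..1} u * I \<omega> u n)) \<partial>lborel) \<noteq> \<infinity>"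
    by (intro nn_integral_PInf_AE) measurable
  then show ?thesis
    using AE_space
  proof eventually_elim
    case (elim \<omega>)
    note [measurable] = I_path[OF elim(2)]
    have "AE u in lborel. (\<Sum>n. ennreal (r n powr (- t)) * (indicator {0..1} u * I \<omega> u n)) \<noteq> \<infinity>"
      using elim(1) by (intro nn_integral_PInf_AE) measurable
    then have "AE u in lborel. u \<in> {0..1} \<longrightarrow> (\<Sum>n. ennreal (r n powr (- t)) * I \<omega> u n) < \<infinity>"
    proof eventually_elim
      case (elim u)
      show ?case
      proof
        assume "u \<in> {0..1}"
        then have "indicator {0..1} u = (1 :: ennreal)" by (rule indicator_simps)
        then show "(\<Sum>n. ennreal (r n powr (- t)) * I \<omega> u n) < \<infinity>"
          using elim by (simp only: mult_1 infinity_ennreal_def less_top not_False_eq_True)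
      qed
    qed
    then show ?case
      unfolding I_def by (rule le_Dim_FH_range[OF elim(2) s t r(1) lim])
  qed
qed

end

section \<open>The dimension profile of the range\<close>

text \<open>
  The two bounds hold almost surely for each exponent, hence simultaneously for all rational
  exponents, and these determine an extended real number.
\<close>

lemma (in nonzero_subordinator) AE_Dim_FH_range:
  assumes s: "0 < s"
  shows "AE \<omega> in M. Dim_FH s ((\<lambda>t. S t \<omega>) ` {0..1}) = ereal s * (1 - theta_index s \<Phi>)"
proof -
  let ?J = "reciprocal_integral s"
  define L where "L = ereal s * (1 - theta_index s \<Phi>)"
  have \<theta>: "theta_index s \<Phi> = Liminf at_top (\<lambda>l. ereal (1 / ln l * ln (?J l)))"
    by (simp add: theta_index_def reciprocal_integral_def)
  obtain C1 C2 where C: "0 < C1" "0 < C2"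
    "\<And>r. 0 < r \<Longrightarrow> 2 \<le> r powr (- s) \<Longrightarrow> C1 * (r powr s * ?J (r powr (- s))) \<le> enn2real (mean_potential s r)"
    "\<And>r. 0 < r \<Longrightarrow> 2 \<le> r powr (- s) \<Longrightarrow> enn2real (mean_potential s r) \<le> C2 * (r powr s * ?J (r powr (- s)))"
    using mean_potential_bounds[OF s] by blast
  have J: "0 < ?J l" if "2 \<le> l" for l
    using reciprocal_integral_bounds(4)[OF s, of l] that by simp
  have \<theta>1: "theta_index s \<Phi> \<le> 1"
    unfolding \<theta>
  proof (rule Liminf_log_ratio_le_1[of "1 / \<Phi> 1"])
    show "0 < 1 / \<Phi> 1" using exponent_pos[of 1] by simp
    show "?J l \<le> 1 / \<Phi> 1 * l" if "2 \<le> l" for l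
      using reciprocal_integral_bounds(3)[OF s, of l] that by simp
  qed (rule J)
  have L0: "0 \<le> L"
    unfolding L_def using \<theta>1 s by (intro ereal_0_le_mult) (auto simp: ereal_diff_positive)
  have upper: "AE \<omega> in M. Dim_FH s ((\<lambda>t. S t \<omega>) ` {0..1}) \<le> ereal t" if "L < ereal t" for t
  proof (rule AE_Dim_FH_range_le[OF s])
    show "0 < t" using L0 that by (metis ereal_less(2) le_less_trans)
    show "summable (\<lambda>n. ((1 / 2) ^ n) powr t / enn2real (mean_potential s ((1 / 2) ^ n)))"
      by (rule summable_powr_inverse[OF s that[unfolded L_def \<theta>] \<theta>1[unfolded \<theta>] J C(1,3)])
  qed
  have lower: "AE \<omega> in M. ereal t \<le> Dim_FH s ((\<lambda>t. S t \<omega>) ` {0..1})" if "ereal t < L" "0 \<le> t" for t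
  proof (rule AE_le_Dim_FH_range[OF s that(2)])
    show "\<exists>r>0. r < e \<and> r powr (- t) * enn2real (mean_potential s r) \<le> e" if "0 < e" for e
      using exists_radius_powr_small[OF s \<open>ereal t < L\<close>[unfolded L_def \<theta>] J C(2,4) that] by blast
  qed
  have "AE \<omega> in M. \<forall>q::rat. (L < ereal (of_rat q) \<longrightarrow> Dim_FH s ((\<lambda>t. S t \<omega>) ` {0..1}) \<le> ereal (of_rat q))
      \<and> (ereal (of_rat q) < L \<and> 0 \<le> (of_rat q :: real) \<longrightarrow> ereal (of_rat q) \<le> Dim_FH s ((\<lambda>t. S t \<omega>) ` {0..1}))"
    unfolding AE_all_countable using upper lower by (intro allI AE_conjI AE_impI) auto
  then show ?thesis
  proof eventually_elim
    case (elim \<omega>)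
    let ?D = "Dim_FH s ((\<lambda>t. S t \<omega>) ` {0..1})"
    have D0: "0 \<le> ?D" unfolding Dim_FH_def by (intro Sup_upper) simp
    have "\<not> L < ?D"
    proof
      assume "L < ?D"
      then obtain q :: rat where "L < ereal (of_rat q)" "ereal (of_rat q) < ?D" using ereal_dense3 by blast
      then show False using elim by (meson not_le)
    qed
    moreover have "\<not> ?D < L"
    proof
      assume "?D < L"
      then obtain q :: rat where q: "?D < ereal (of_rat q)" "ereal (of_rat q) < L" using ereal_dense3 by blast
      have "0 < ereal (of_rat q)" using D0 q(1) by (rule le_less_trans)
      then show False using q elim by (meson ereal_less(2) less_imp_le not_le)
    qed
    ultimately show ?case unfolding L_def[symmetric] by (rule antisym_conv3[THEN iffD1])
  qed
qed

theorem corollary1p3: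
  fixes M :: "'a measure" and S :: "real \<Rightarrow> 'a \<Rightarrow> real" and \<Phi> :: "real \<Rightarrow> real" and s :: real
  assumes "subordinator M S"
    and "laplace_exponent M S \<Phi>"
    and nonzero: "\<exists>t\<ge>0. \<not> (AE \<omega> in M. S t \<omega> = 0)"
    and "s \<ge> 1 / 2"
  shows "AE \<omega> in M. Dim_FH s ((\<lambda>t. S t \<omega>) ` {0..1}) = ereal s * (1 - theta_index s \<Phi>)"
proof -
  interpret S: subordinator M S by fact
  obtain X where X: "regular_subordinator M X" and eq: "AE \<omega> in M. \<forall>t. X t \<omega> = S t \<omega>"
    using S.regular_version by blast
  interpret X: regular_subordinator M X by fact
  have "nonzero_subordinator M X \<Phi>"
  proof (intro nonzero_subordinator.intro X nonzero_subordinator_axioms.intro)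
    have "(\<integral>\<omega>. exp (- l * X t \<omega>) \<partial>M) = (\<integral>\<omega>. exp (- l * S t \<omega>) \<partial>M)" if "0 < t" for l t
    proof (rule integral_cong_AE)
      show "AE \<omega> in M. exp (- l * X t \<omega>) = exp (- l * S t \<omega>)" using eq by eventually_elim simp
      show "(\<lambda>\<omega>. exp (- l * X t \<omega>)) \<in> borel_measurable M"
        using X.measurable_process[OF less_imp_le[OF that]] by measurable
      show "(\<lambda>\<omega>. exp (- l * S t \<omega>)) \<in> borel_measurable M"
        using S.measurable_process[OF less_imp_le[OF that]] by measurable
    qed
    then show "laplace_exponent M X \<Phi>"
      using assms(2) by (simp add: laplace_exponent_def)
    show "\<exists>t\<ge>0. \<not> (AE \<omega> in M. X t \<omega> = 0)"
    proof -
      obtain t where t: "0 \<le> t" "\<not> (AE \<omega> in M. S t \<omega> = 0)" using nonzero by blast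
      have "AE \<omega> in M. S t \<omega> = 0" if "AE \<omega> in M. X t \<omega> = 0"
        using that eq by eventually_elim simp
      then show ?thesis using t by blast
    qed
  qed
  then interpret X: nonzero_subordinator M X \<Phi> .
  have "0 < s" using assms(4) by simp
  from X.AE_Dim_FH_range[OF this] eq show ?thesis
    by eventually_elim simp
qed

end
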